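(* Let $X$ be the scalar Itô diffusion $dX_t=f_t(X_t)\,dt+\sigma_t(X_t)\,dW_t$ with $a_t=\sigma_t^2$, and let $EM(c)=\{p(\cdot,\theta):\theta\in\Theta\}$ be the exponential family with sufficient statistics $c=(c_1,\dots,c_m)^T$. Assume that conditions (A), (B), (C), (E), (F) of the context hold for $f$, $a$, $X_0$ and $c$. Then the orthogonal projection onto $EM(c)$ of the Fokker–Planck equation describing the evolution of the density of $X_t$, i.e. the equation for a curve $t\mapsto p(\cdot,\theta_t)$ in $EM(c)$ stating that its tangent vector at time $t$ equals $\Pi_{\theta_t}\big[\mathcal L_t^\ast p(\cdot,\theta_t)/p(\cdot,\theta_t)\big]$, reads, in exponential coordinates $B_{p(\cdot,\theta_t)}$, $$[c(\cdot)-E_{\theta_t}c]^T\,\dot\theta_t=E_{\theta_t}[\mathcal L_t c]^T\,g^{-1}(\theta_t)\,[c(\cdot)-E_{\theta_t}c],$$ and the differential equation describing the evolution of the parameters of the projected density is $$\dot\theta_t=g^{-1}(\theta_t)\,E_{\theta_t}\{\mathcal L_t\,c\}.$$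
   Context: **Diffusion.** $W$ is a standard Brownian motion independent of $X_0$, and the state space is $\mathbb R$. The operators are $$\mathcal L_t=f_t\,\partial_x+\tfrac12a_t\,\partial_x^2,\qquad \mathcal L_t^\ast p=-\partial_x(f_tp)+\tfrac12\partial_x^2(a_tp),$$ and the Fokker–Planck equation is $\partial_tp_t=\mathcal L_t^\ast p_t$. In exponential coordinates at $p_t$ its tangent vector is $\mathcal L_t^\ast p_t/p_t$. **Exponential family.** $EM(c)=\{p(\cdot,\theta):\theta\in\Theta\}$ with $\Theta\subset\mathbb R^m$ open, where $p(x,\theta)=\exp[\theta^Tc(x)-\psi(\theta)]$ is a probability density with respect to Lebesgue measure on $\mathbb R$ (so $\psi(\theta)=\log\int e^{\theta^Tc(x)}dx$). $E_\theta\phi=\int\phi(x)p(x,\theta)\,dx$, applied componentwise to vector functions; $\mathcal L_tc$ is also componentwise. **Assumptions.** (A) $X_0$ has a density $p_0$ with respect to Lebesgue measure, with $p_0>0$ a.e. (B) $f\in C^{1,0}$ and $a\in C^{2,0}$: $f$ is once, respectively $a$ twice, continuously differentiable in $x$, and both are continuous in $t$. (C) There is $K>0$ with $2xf_t(x)+a_t(x)\le K(1+|x|^2)$ for all $t\ge0$, $x\in\mathbb R$. (E) $c\in C^2$. (F) $E_\theta\{\alpha_{t,\theta}^2\}<\infty$ for all $\theta\in\Theta$ (and all $t\ge 0$), where $$\alpha_{t,\theta}=\frac{\mathcal L_t^\ast p(\cdot,\theta)}{p(\cdot,\theta)}=-f_t\,\partial_x(\theta^Tc)-\partial_xf_t+\tfrac12\big[a_t\,\partial_x^2(\theta^Tc)+a_t(\partial_x(\theta^Tc))^2+2\,\partial_xa_t\,\partial_x(\theta^Tc)+\partial_x^2a_t\big].$$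 **Tangent space and projection.** For a density $p$, the exponential coordinate of a density $q$ near $p$ is $s_p(q)=\log\frac qp-\mathbb E_p[\log\frac qp]$, with $\mathbb E_p$ the expectation under $p(x)\,dx$. It takes values in $B_p$, the Banach space of random variables with zero $p$-mean and with $\mathbb E_p[e^{tu}]<\infty$ for $t$ near $0$. The tangent vector at time $t$ of a differentiable curve $t\mapsto p(\cdot,\theta_t)$ is $$\partial_h s_{p(\cdot,\theta_t)}(p(\cdot,\theta_{t+h}))|_{h=0},$$ and the tangent space of $EM(c)$ at $\theta$ is $$T_\theta EM(c)=\mathrm{span}\{c_i-E_\theta c_i:\ i=1,\dots,m\}.$$ Let $\langle v_1,v_2\rangle_\theta=E_\theta[v_1v_2]$ and let $g(\theta)_{ij}=\langle c_i-E_\theta c_i,\,c_j-E_\theta c_j\rangle_\theta$ (the Fisher information matrix), assumed invertible with inverse entries $g^{ij}(\theta)$. The orthogonal projection is $$\Pi_\theta[v]=\sum_{i=1}^m\Big[\sum_{j=1}^m g^{ij}(\theta)\,\langle v,\,c_j-E_\theta c_j\rangle_\theta\Big](c_i-E_\theta c_i),$$ defined by this formula for $v$ with $E_\theta[v^2]<\infty$. *)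

theory Defs
  imports "HOL-Probability.Probability"
begin

section \<open>Ito diffusions\<close>

text \<open>
  Processes are indexed by \<open>real\<close>; only times \<open>t \<ge> 0\<close> carry meaning.
\<close>

definition filtered_prob_space :: "'w measure \<Rightarrow> (real \<Rightarrow> 'w measure) \<Rightarrow> bool" where
  "filtered_prob_space M F \<longleftrightarrow>
     prob_space M \<and> filtration (space M) F \<and> (\<forall>t. subalgebra M (F t))"

definition brownian_motion ::
  "'w measure \<Rightarrow> (real \<Rightarrow> 'w measure) \<Rightarrow> (real \<Rightarrow> 'w \<Rightarrow> real) \<Rightarrow> bool" where
  "brownian_motion M F W \<longleftrightarrow>
     (\<forall>t\<ge>0. W t \<in> borel_measurable (F t)) \<and>
     (AE \<omega> in M. W 0 \<omega> = 0) \<and>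
     (AE \<omega> in M. continuous_on {0..} (\<lambda>t. W t \<omega>)) \<and>
     (\<forall>s\<ge>0. \<forall>t>s.
        distributed M lborel (\<lambda>\<omega>. W t \<omega> - W s \<omega>) (normal_density 0 (sqrt (t - s))) \<and>
        prob_space.indep_set M (sets (F s))
          (sets (vimage_algebra (space M) (\<lambda>\<omega>. W t \<omega> - W s \<omega>) borel)))"

definition progressive ::
  "(real \<Rightarrow> 'w measure) \<Rightarrow> (real \<Rightarrow> 'w \<Rightarrow> real) \<Rightarrow> bool" where
  "progressive F H \<longleftrightarrow>
     (\<forall>t\<ge>0. (\<lambda>(s, \<omega>). H s \<omega>) \<in> borel_measurable (restrict_space borel {0..t} \<Otimes>\<^sub>M F t))"

text \<open>
  The triple \<open>(n, \<tau>, \<xi>)\<close> encodes the simple process equal to \<open>\<xi> k\<close> on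
  \<open>(\<tau> k, \<tau> (k + 1)]\<close> for \<open>k < n\<close> and to 0 elsewhere.
\<close>

definition simple_data ::
  "(real \<Rightarrow> 'w measure) \<Rightarrow> nat \<Rightarrow> (nat \<Rightarrow> real) \<Rightarrow> (nat \<Rightarrow> 'w \<Rightarrow> real) \<Rightarrow> bool" where
  "simple_data F n \<tau> \<xi> \<longleftrightarrow>
     0 \<le> \<tau> 0 \<and> mono \<tau> \<and>
     (\<forall>k<n. \<xi> k \<in> borel_measurable (F (\<tau> k)) \<and>
            (\<exists>C. \<forall>\<omega>\<in>space (F (\<tau> k)). \<bar>\<xi> k \<omega>\<bar> \<le> C))"

definition simple_process ::
  "nat \<Rightarrow> (nat \<Rightarrow> real) \<Rightarrow> (nat \<Rightarrow> 'w \<Rightarrow> real) \<Rightarrow> real \<Rightarrow> 'w \<Rightarrow> real" where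
  "simple_process n \<tau> \<xi> s \<omega> = (\<Sum>k<n. \<xi> k \<omega> * indicator {\<tau> k <.. \<tau> (Suc k)} s)"

definition simple_integral_upto ::
  "(real \<Rightarrow> 'w \<Rightarrow> real) \<Rightarrow> nat \<Rightarrow> (nat \<Rightarrow> real) \<Rightarrow> (nat \<Rightarrow> 'w \<Rightarrow> real) \<Rightarrow> real \<Rightarrow> 'w \<Rightarrow> real" where
  "simple_integral_upto W n \<tau> \<xi> t \<omega> =
     (\<Sum>k<n. \<xi> k \<omega> * (W (min t (\<tau> (Suc k))) \<omega> - W (min t (\<tau> k)) \<omega>))"

definition null_in_prob :: "'w measure \<Rightarrow> (nat \<Rightarrow> 'w \<Rightarrow> ennreal) \<Rightarrow> bool" where
  "null_in_prob M Z \<longleftrightarrow>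
     (\<forall>j. Z j \<in> borel_measurable M) \<and>
     (\<forall>\<epsilon>>0. (\<lambda>j. measure M {\<omega>\<in>space M. ennreal \<epsilon> < Z j \<omega>}) \<longlonglongrightarrow> 0)"

text \<open>
  \<open>Y\<close> is (a version of) the Ito integral of \<open>H\<close> with respect to \<open>W\<close> over \<open>[0, t]\<close>, for a
  progressive integrand with locally square-integrable paths: the limit in probability of
  integrals of simple processes approximating \<open>H\<close> in \<open>L\<^sup>2[0, t]\<close>, in probability.
\<close>

definition is_ito_integral ::
  "'w measure \<Rightarrow> (real \<Rightarrow> 'w measure) \<Rightarrow> (real \<Rightarrow> 'w \<Rightarrow> real) \<Rightarrow> (real \<Rightarrow> 'w \<Rightarrow> real)
     \<Rightarrow> real \<Rightarrow> ('w \<Rightarrow> real) \<Rightarrow> bool" where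
  "is_ito_integral M F W H t Y \<longleftrightarrow>
     progressive F H \<and>
     (\<exists>n \<tau> \<xi>.
        (\<forall>j. simple_data F (n j) (\<tau> j) (\<xi> j)) \<and>
        null_in_prob M (\<lambda>j \<omega>. \<integral>\<^sup>+s\<in>{0..t}.
            ennreal ((simple_process (n j) (\<tau> j) (\<xi> j) s \<omega> - H s \<omega>)\<^sup>2) \<partial>lborel) \<and>
        null_in_prob M (\<lambda>j \<omega>.
            ennreal \<bar>simple_integral_upto W (n j) (\<tau> j) (\<xi> j) t \<omega> - Y \<omega>\<bar>))"

text \<open>\<open>dX\<^sub>t = f\<^sub>t(X\<^sub>t) dt + \<sigma>\<^sub>t(X\<^sub>t) dW\<^sub>t\<close> with \<open>W\<close> independent of \<open>X\<^sub>0\<close>\<close>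

definition ito_diffusion ::
  "'w measure \<Rightarrow> (real \<Rightarrow> 'w measure) \<Rightarrow> (real \<Rightarrow> 'w \<Rightarrow> real)
     \<Rightarrow> (real \<Rightarrow> real \<Rightarrow> real) \<Rightarrow> (real \<Rightarrow> real \<Rightarrow> real) \<Rightarrow> (real \<Rightarrow> 'w \<Rightarrow> real) \<Rightarrow> bool" where
  "ito_diffusion M F W f \<sigma> X \<longleftrightarrow>
     filtered_prob_space M F \<and>
     brownian_motion M F W \<and>
     prob_space.indep_set M (sets (vimage_algebra (space M) (X 0) borel))
       (sets (vimage_algebra (space M) (\<lambda>\<omega>. \<lambda>t\<in>{0..}. W t \<omega>) (Pi\<^sub>M {0..} (\<lambda>_. borel)))) \<and>
     (\<forall>t\<ge>0. X t \<in> borel_measurable (F t)) \<and>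
     (AE \<omega> in M. continuous_on {0..} (\<lambda>t. X t \<omega>)) \<and>
     progressive F (\<lambda>s \<omega>. f s (X s \<omega>)) \<and>
     (\<forall>t\<ge>0. (AE \<omega> in M. set_integrable lborel {0..t} (\<lambda>s. f s (X s \<omega>))) \<and>
        is_ito_integral M F W (\<lambda>s \<omega>. \<sigma> s (X s \<omega>)) t
          (\<lambda>\<omega>. X t \<omega> - X 0 \<omega> - (LINT s:{0..t}|lborel. f s (X s \<omega>))))"


section \<open>Backward and forward operators\<close>

definition Ck :: "nat \<Rightarrow> (real \<Rightarrow> real) \<Rightarrow> bool" where
  "Ck k \<phi> \<longleftrightarrow>
     (\<forall>j<k. (deriv ^^ j) \<phi> differentiable_on UNIV) \<and> continuous_on UNIV ((deriv ^^ k) \<phi>)"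

definition generator ::
  "(real \<Rightarrow> real \<Rightarrow> real) \<Rightarrow> (real \<Rightarrow> real \<Rightarrow> real) \<Rightarrow> real \<Rightarrow> (real \<Rightarrow> real) \<Rightarrow> real \<Rightarrow> real" where
  "generator f a t \<phi> x = f t x * deriv \<phi> x + a t x * deriv (deriv \<phi>) x / 2"

definition fokker_planck_op ::
  "(real \<Rightarrow> real \<Rightarrow> real) \<Rightarrow> (real \<Rightarrow> real \<Rightarrow> real) \<Rightarrow> real \<Rightarrow> (real \<Rightarrow> real) \<Rightarrow> real \<Rightarrow> real" where
  "fokker_planck_op f a t p x =
     - deriv (\<lambda>y. f t y * p y) x + deriv (deriv (\<lambda>y. a t y * p y)) x / 2"


section \<open>Exponential coordinates\<close>

definition dens_measure :: "(real \<Rightarrow> real) \<Rightarrow> real measure" where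
  "dens_measure p = density lborel (\<lambda>x. ennreal (p x))"

definition expect :: "(real \<Rightarrow> real) \<Rightarrow> (real \<Rightarrow> real) \<Rightarrow> real" where
  "expect p \<phi> = (\<integral>x. \<phi> x \<partial>dens_measure p)"

definition exp_coord :: "(real \<Rightarrow> real) \<Rightarrow> (real \<Rightarrow> real) \<Rightarrow> real \<Rightarrow> real" where
  "exp_coord p q x = ln (q x / p x) - expect p (\<lambda>y. ln (q y / p y))"

text \<open>Elements of the Banach space \<open>B\<^sub>p\<close> are represented by functions, identified almost everywhere.\<close>

definition Bspace :: "(real \<Rightarrow> real) \<Rightarrow> (real \<Rightarrow> real) set" where
  "Bspace p = {u \<in> borel_measurable lborel.
     integrable (dens_measure p) u \<and> expect p u = 0 \<and>
     (\<exists>\<epsilon>>0. \<forall>t. \<bar>t\<bar> < \<epsilon> \<longrightarrow> integrable (dens_measure p) (\<lambda>x. exp (t * u x)))}"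

text \<open>
  The norm of \<open>B\<^sub>p\<close> is the Luxemburg norm of the Orlicz space of the Young function
  \<open>cosh - 1\<close>. The set below is nonempty for \<open>u \<in> Bspace p\<close>; outside the Orlicz space the
  value is meaningless.
\<close>

definition Bnorm :: "(real \<Rightarrow> real) \<Rightarrow> (real \<Rightarrow> real) \<Rightarrow> real" where
  "Bnorm p u = Inf {r. 0 < r \<and> integrable (dens_measure p) (\<lambda>x. cosh (u x / r) - 1) \<and>
                         expect p (\<lambda>x. cosh (u x / r) - 1) \<le> 1}"

text \<open>
  \<open>v\<close> is the derivative at \<open>t\<close>, in the norm of \<open>Bspace (q t)\<close>, of the curve
  \<open>s \<mapsto> exp_coord (q t) (q s)\<close>. The time set \<open>I\<close> allows for one-sided derivatives
  at its end points.
\<close>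

definition has_tangent_vector ::
  "(real \<Rightarrow> real \<Rightarrow> real) \<Rightarrow> (real \<Rightarrow> real) \<Rightarrow> real \<Rightarrow> real set \<Rightarrow> bool" where
  "has_tangent_vector q v t I \<longleftrightarrow>
     v \<in> Bspace (q t) \<and>
     (\<forall>\<^sub>F s in at t within I. exp_coord (q t) (q s) \<in> Bspace (q t)) \<and>
     ((\<lambda>s. Bnorm (q t) (\<lambda>x.
          (exp_coord (q t) (q s) x - exp_coord (q t) (q t) x) / (s - t) - v x)) \<longlongrightarrow> 0)
       (at t within I)"


section \<open>Exponential families\<close>

definition log_partition :: "(real \<Rightarrow> real^'m) \<Rightarrow> real^'m \<Rightarrow> real" where
  "log_partition c \<theta> = ln (\<integral>x. exp (\<theta> \<bullet> c x) \<partial>lborel)"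

definition em_density :: "(real \<Rightarrow> real^'m) \<Rightarrow> real^'m \<Rightarrow> real \<Rightarrow> real" where
  "em_density c \<theta> x = exp (\<theta> \<bullet> c x - log_partition c \<theta>)"

definition exponential_family :: "(real \<Rightarrow> real^'m) \<Rightarrow> (real^'m) set \<Rightarrow> bool" where
  "exponential_family c \<Theta> \<longleftrightarrow>
     open \<Theta> \<and> (\<forall>\<theta>\<in>\<Theta>. prob_space (dens_measure (em_density c \<theta>)))"

definition em_expect :: "(real \<Rightarrow> real^'m) \<Rightarrow> real^'m \<Rightarrow> (real \<Rightarrow> real) \<Rightarrow> real" where
  "em_expect c \<theta> \<phi> = expect (em_density c \<theta>) \<phi>"

definition em_generator_expect ::
  "(real \<Rightarrow> real \<Rightarrow> real) \<Rightarrow> (real \<Rightarrow> real \<Rightarrow> real) \<Rightarrow> real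
     \<Rightarrow> (real \<Rightarrow> real^'m) \<Rightarrow> real^'m \<Rightarrow> real^'m" where
  "em_generator_expect f a t c \<theta> = (\<chi> i. em_expect c \<theta> (generator f a t (\<lambda>x. c x $ i)))"

definition em_centred :: "(real \<Rightarrow> real^'m) \<Rightarrow> real^'m \<Rightarrow> real \<Rightarrow> real^'m" where
  "em_centred c \<theta> x = (\<chi> i. c x $ i - em_expect c \<theta> (\<lambda>y. c y $ i))"

definition em_inner ::
  "(real \<Rightarrow> real^'m) \<Rightarrow> real^'m \<Rightarrow> (real \<Rightarrow> real) \<Rightarrow> (real \<Rightarrow> real) \<Rightarrow> real" where
  "em_inner c \<theta> v w = em_expect c \<theta> (\<lambda>x. v x * w x)"

definition fisher :: "(real \<Rightarrow> real^'m) \<Rightarrow> real^'m \<Rightarrow> real^'m^'m" where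
  "fisher c \<theta> =
     (\<chi> i j. em_inner c \<theta> (\<lambda>x. em_centred c \<theta> x $ i) (\<lambda>x. em_centred c \<theta> x $ j))"

definition em_proj :: "(real \<Rightarrow> real^'m) \<Rightarrow> real^'m \<Rightarrow> (real \<Rightarrow> real) \<Rightarrow> real \<Rightarrow> real" where
  "em_proj c \<theta> v x =
     (\<Sum>i\<in>UNIV. (\<Sum>j\<in>UNIV. matrix_inv (fisher c \<theta>) $ i $ j *
                  em_inner c \<theta> v (\<lambda>y. em_centred c \<theta> y $ j)) * em_centred c \<theta> x $ i)"

definition fp_vector ::
  "(real \<Rightarrow> real \<Rightarrow> real) \<Rightarrow> (real \<Rightarrow> real \<Rightarrow> real) \<Rightarrow> real
     \<Rightarrow> (real \<Rightarrow> real^'m) \<Rightarrow> real^'m \<Rightarrow> real \<Rightarrow> real" where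
  "fp_vector f a t c \<theta> x =
     fokker_planck_op f a t (em_density c \<theta>) x / em_density c \<theta> x"

end

theory Submission
  imports Defs
begin

text \<open>
  By integration by parts, \<open>\<langle>\<L>\<^sup>* p / p, c\<^sub>i - E c\<^sub>i\<rangle> = E (\<L> c\<^sub>i)\<close>. The justification comes from the openness
  of \<open>\<Theta>\<close>: \<open>\<L>\<^sup>* p / p\<close> is quadratic along a line \<open>\<theta> + s d\<close>, so square integrability at several \<open>s\<close>
  bounds all its coefficients, and the probability flux vanishes at infinity, since otherwise the
  density would be bounded below there.

  For the tangent vectors, \<open>s\<^sub>p\<close> maps \<open>p(\<cdot>, \<zeta>)\<close> to the linear expression \<open>(\<zeta> - \<theta>)\<^sup>T (c - E c)\<close>. The norm of
  \<open>B\<^sub>p\<close> restricted to such expressions is equivalent to the Euclidean norm of the coefficient vector, because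
  the Fisher matrix is invertible; hence the curve has a tangent vector \<open>D\<^sup>T (c - E c)\<close> exactly when
  \<open>\<theta>\<close> has derivative \<open>D\<close>.
\<close>

section \<open>Integrable derivatives on the real line\<close>

text \<open>Condition (F) does not say that \<L> c_i is integrable, and the derivatives of c may
  oscillate. Write p for the density, J for its flux, v for c_i and N = a p v'. Then (\<L> v) p = v'
  J + N' / 2. Integrability of J' bounds J, and openness makes v' N integrable, but neither controls
  v' J. What helps is N' = 2 (v' J + b) with b integrable: N has the sign of v', so a large v' J
  forces N to move. Boundary terms raise a second difficulty. With its exponential tilt removed, the
  flux is affine in the position on a line of densities. This forces its limit to be 0 only if the
  tilt is comparable with a power of p, which holds on lines through the origin of parameter space.
  Coordinate lines, which produce the c_i, inherit the result because each of their densities has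
  its own line through the origin.\<close>

lemma bounded_of_integrable_deriv:
  fixes F F' :: "real \<Rightarrow> real"
  assumes d: "\<And>x. (F has_real_derivative F' x) (at x)"
    and c: "continuous_on UNIV F'" and i: "integrable lborel F'"
  shows "\<bar>F x - F y\<bar> \<le> (\<integral>x. \<bar>F' x\<bar> \<partial>lborel)"
proof -
  have *: "\<bar>F x - F y\<bar> \<le> (\<integral>x. \<bar>F' x\<bar> \<partial>lborel)" if "y \<le> x" for x y
  proof -
    have "has_bochner_integral lborel (\<lambda>z. F' z * indicator {y..x} z) (F x - F y)"
      using d c that continuous_on_eq_continuous_at[of UNIV F']
      by (intro has_bochner_integral_FTC_Icc_real) auto
    then have "F x - F y = (\<integral>z. F' z * indicator {y..x} z \<partial>lborel)"
      by (simp add: has_bochner_integral_integral_eq)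
    also have "\<bar>\<dots>\<bar> \<le> (\<integral>z. \<bar>F' z * indicator {y..x} z\<bar> \<partial>lborel)"
      by (rule integral_abs_bound)
    also have "\<dots> \<le> (\<integral>z. \<bar>F' z\<bar> \<partial>lborel)"
      using i by (intro integral_mono integrable_abs integrable_real_mult_indicator)
        (auto simp: indicator_def)
    finally show ?thesis .
  qed
  show ?thesis
    using *[of x y] *[of y x] by (cases "x \<le> y") (auto simp: abs_minus_commute)
qed

text \<open>\<open>F x\<close> is \<open>F 0\<close> plus the integral of \<open>F'\<close> over
  [0, x], which converges by dominated convergence. The flux must be known to have limits before
  they can be shown to be zero.\<close>

lemma convergent_at_top_of_integrable_deriv:
  fixes F F' :: "real \<Rightarrow> real"
  assumes d: "\<And>x. (F has_real_derivative F' x) (at x)"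
    and c: "continuous_on UNIV F'" and i: "integrable lborel F'"
  shows "\<exists>L. (F \<longlongrightarrow> L) at_top"
proof -
  let ?g = "\<lambda>z. F' z * indicator {0..} z"
  have "integrable lborel ?g"
    using i by (intro integrable_real_mult_indicator) auto
  then have "((\<lambda>x. \<integral>z. indicator {..x} z *\<^sub>R ?g z \<partial>lborel) \<longlongrightarrow> (\<integral>z. ?g z \<partial>lborel)) at_top"
    by (intro tendsto_integral_at_top) auto
  then have "((\<lambda>x. F 0 + (\<integral>z. indicator {..x} z *\<^sub>R ?g z \<partial>lborel))
      \<longlongrightarrow> F 0 + (\<integral>z. ?g z \<partial>lborel)) at_top"
    by (intro tendsto_intros)
  moreover have "\<forall>\<^sub>F x in at_top. F 0 + (\<integral>z. indicator {..x} z *\<^sub>R ?g z \<partial>lborel) = F x"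
    using eventually_ge_at_top[of 0]
  proof eventually_elim
    case (elim x)
    have "has_bochner_integral lborel (\<lambda>z. F' z * indicator {0..x} z) (F x - F 0)"
      using d c elim continuous_on_eq_continuous_at[of UNIV F']
      by (intro has_bochner_integral_FTC_Icc_real) auto
    moreover have "(\<lambda>z. F' z * indicator {0..x} z) = (\<lambda>z. indicator {..x} z *\<^sub>R ?g z)"
      by (auto simp: indicator_def)
    ultimately show ?case
      by (simp add: has_bochner_integral_integral_eq)
  qed
  ultimately show ?thesis
    by (blast intro: Lim_transform_eventually)
qed

lemma integrable_lborel_reflect:
  fixes g :: "real \<Rightarrow> real"
  assumes "integrable lborel g"
  shows "integrable lborel (\<lambda>x. g (- x))"
  using lborel_integrable_real_affine[OF assms, of "-1" 0] by simp

lemma convergent_at_bot_of_integrable_deriv: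
  fixes F F' :: "real \<Rightarrow> real"
  assumes d: "\<And>x. (F has_real_derivative F' x) (at x)"
    and c: "continuous_on UNIV F'" and i: "integrable lborel F'"
  shows "\<exists>L. (F \<longlongrightarrow> L) at_bot"
proof -
  have "((\<lambda>y. F (- y)) has_real_derivative - F' (- x)) (at x)" for x
    using d[of "- x"] by (auto simp: DERIV_mirror)
  moreover have "continuous_on UNIV (\<lambda>x. - F' (- x))"
    using continuous_on_compose2[OF c, of UNIV uminus] continuous_on_minus[OF continuous_on_id]
    by (auto intro!: continuous_on_minus)
  moreover have "integrable lborel (\<lambda>x. - F' (- x))"
    using integrable_lborel_reflect[OF i] by simp
  ultimately obtain L where "((\<lambda>y. F (- y)) \<longlongrightarrow> L) at_top"
    using convergent_at_top_of_integrable_deriv[of "\<lambda>y. F (- y)" "\<lambda>x. - F' (- x)"] by blast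
  then show ?thesis
    by (auto simp: filterlim_at_bot_mirror)
qed

lemma integral_deriv_eq_0:
  fixes F F' :: "real \<Rightarrow> real"
  assumes d: "\<And>x. (F has_real_derivative F' x) (at x)"
    and c: "continuous_on UNIV F'" and i: "integrable lborel F'"
    and "(F \<longlongrightarrow> 0) at_top" "(F \<longlongrightarrow> 0) at_bot"
  shows "(\<integral>x. F' x \<partial>lborel) = 0"
proof -
  have "(LBINT x=-\<infinity>..\<infinity>. F' x) = 0 - 0"
    using assms continuous_on_eq_continuous_at[of UNIV F']
    by (intro interval_integral_FTC_integrable)
      (auto simp: has_real_derivative_iff_has_vector_derivative[symmetric]
         set_integrable_def ereal_tendsto_simps)
  then show ?thesis
    by (simp add: interval_lebesgue_integral_def set_lebesgue_integral_def)
qed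

lemma not_integrable_at_top_of_lower_bound:
  fixes w :: "real \<Rightarrow> real"
  assumes i: "integrable lborel w" and "\<And>x. 0 \<le> w x" and "k > 0" and "\<forall>\<^sub>F x in at_top. k \<le> w x"
  shows False
proof -
  obtain b where b: "\<And>x. x \<ge> b \<Longrightarrow> k \<le> w x"
    using assms(4) by (auto simp: eventually_at_top_linorder)
  have "integrable lborel (\<lambda>x. k * indicator {b..} x)"
    using assms b by (intro Bochner_Integration.integrable_bound[OF i]) (auto simp: indicator_def)
  then have "emeasure lborel {b..} < \<infinity>"
    using \<open>k > 0\<close> by (simp add: integrable_indicator_iff)
  moreover have "emeasure lborel {b..} = \<infinity>"
  proof (rule ccontr)
    assume "emeasure lborel {b..} \<noteq> \<infinity>"
    then obtain r where r: "emeasure lborel {b..} = ennreal r" "r \<ge> 0"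
      by (cases "emeasure lborel {b..}") auto
    have "emeasure lborel {b..b + r + 1} \<le> emeasure lborel {b..}"
      by (intro emeasure_mono) auto
    then show False using r by (simp add: ennreal_le_iff)
  qed
  ultimately show False by simp
qed

lemma not_integrable_at_bot_of_lower_bound:
  fixes w :: "real \<Rightarrow> real"
  assumes i: "integrable lborel w" and "\<And>x. 0 \<le> w x" and "k > 0" and "\<forall>\<^sub>F x in at_bot. k \<le> w x"
  shows False
proof -
  have "\<forall>\<^sub>F x in at_top. k \<le> w (- x)"
    using assms(4) by (simp add: at_bot_mirror eventually_filtermap)
  then show False
    using not_integrable_at_top_of_lower_bound[OF integrable_lborel_reflect[OF i]] assms by blast
qed

text \<open>
  \<open>J\<close> is bounded, but \<open>g\<close> may oscillate wildly. Where \<open>\<bar>J\<bar> \<le> \<bar>N\<bar>\<close>, the product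
  \<open>g J\<close> is controlled by \<open>g N\<close>. Elsewhere one uses that \<open>N\<close> has the sign of \<open>g\<close>, so
  that \<open>2 \<bar>g J\<bar>\<close> is, up to \<open>b\<close>, the derivative of \<open>sgn J * \<bar>N\<bar>\<close>; the function
  \<open>J \<bar>N\<bar> / sqrt (J\<^sup>2 + N\<^sup>2)\<close> interpolates between the two regimes and is bounded by \<open>\<bar>J\<bar>\<close>.
  It is regularised by \<open>\<epsilon>\<close> at the zeros of \<open>N\<close>.
\<close>

lemma integrable_mult_of_sign_coupling:
  fixes J J' N N' g b \<kappa> \<kappa>' :: "real \<Rightarrow> real"
  assumes dJ: "\<And>x. (J has_real_derivative J' x) (at x)" and cJ': "continuous_on UNIV J'"
    and dN: "\<And>x. (N has_real_derivative N' x) (at x)"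
    and d\<kappa>: "\<And>x. (\<kappa> has_real_derivative \<kappa>' x) (at x)" and \<kappa>0: "\<And>x. 0 \<le> \<kappa> x"
    and dg: "\<And>x. (g has_real_derivative g' x) (at x)"
    and cb: "continuous_on UNIV b"
    and N: "\<And>x. N x = \<kappa> x * g x"
    and N': "\<And>x. N' x = 2 * (g x * J x + b x)"
    and iJ': "integrable lborel J'" and ib: "integrable lborel b"
    and iN: "integrable lborel (\<lambda>x. g x * N x)"
  shows "integrable lborel (\<lambda>x. g x * J x)"
proof -
  have cJ: "continuous_on UNIV J" and cN: "continuous_on UNIV N" and cg: "continuous_on UNIV g"
    using dJ dN dg by (auto intro!: continuous_at_imp_continuous_on DERIV_isCont)
  have N0: "\<bar>g x * J x\<bar> \<le> \<bar>b x\<bar>" if "N x = 0" for x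
  proof (cases "g x = 0")
    case False
    then have "\<kappa> x = 0" using N that by simp
    \<comment> \<open>A zero of the nonnegative \<open>\<kappa>\<close> is a minimum, so
      \<open>\<kappa>'\<close> vanishes there as well; hence \<open>N' x = 0\<close>, and the
      formula for \<open>N'\<close> ties \<open>g x * J x\<close> to \<open>b x\<close>.\<close>
    then have "\<kappa>' x = 0"
      using DERIV_local_min[OF d\<kappa>, of 1] \<kappa>0 by simp
    have "(N has_real_derivative \<kappa> x * g' x + \<kappa>' x * g x) (at x)"
      unfolding N[abs_def] by (auto intro!: derivative_eq_intros d\<kappa> dg)
    then have "N' x = 0"
      using DERIV_unique[OF dN] \<open>\<kappa> x = 0\<close> \<open>\<kappa>' x = 0\<close> by fastforce
    then have "g x * J x = - b x" using N'[of x] by simp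
    then show ?thesis by simp
  qed simp
  define \<nu> where "\<nu> \<epsilon> x = sqrt ((N x)\<^sup>2 + \<epsilon>\<^sup>2)" for \<epsilon> x
  define R where "R \<epsilon> x = sqrt ((J x)\<^sup>2 + (\<nu> \<epsilon> x)\<^sup>2)" for \<epsilon> x
  define G where "G \<epsilon> x = J x * \<nu> \<epsilon> x / R \<epsilon> x" for \<epsilon> x
  \<comment> \<open>\<open>h\<close> is the part of \<open>G'\<close> that contains
    \<open>g * J\<close>. It is nonnegative because \<open>g * N\<close> is \<open>\<kappa>\<close>
    times a square; the rest of \<open>G'\<close> is at most
    \<open>\<bar>J'\<bar> + 2 * \<bar>b\<bar>\<close>.\<close>
  define h where "h \<epsilon> x = 2 * (J x)^4 * (g x * N x) / (\<nu> \<epsilon> x * (R \<epsilon> x)^3)" for \<epsilon> x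
  define G' where "G' \<epsilon> x = (J' x * (\<nu> \<epsilon> x)^3 + (J x)^3 * (N x * N' x / \<nu> \<epsilon> x)) / (R \<epsilon> x)^3" for \<epsilon> x
  define B where "B = \<bar>J 0\<bar> + (\<integral>x. \<bar>J' x\<bar> \<partial>lborel)"
  define K where "K = 2 * B + (\<integral>x. \<bar>J' x\<bar> + 2 * \<bar>b x\<bar> \<partial>lborel)"
  have B: "\<bar>J x\<bar> \<le> B" for x
    using bounded_of_integrable_deriv[OF dJ cJ' iJ', of x 0] unfolding B_def by linarith
  have gN: "0 \<le> g x * N x" for x
    using \<kappa>0[of x] by (simp add: N mult.left_commute[of "g x"])
  have \<nu>0: "0 < \<nu> \<epsilon> x" if "\<epsilon> > 0" for \<epsilon> x
    using that by (simp add: \<nu>_def add_nonneg_pos)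
  have R0: "0 < R \<epsilon> x" if "\<epsilon> > 0" for \<epsilon> x
    using \<nu>0[OF that, of x] by (simp add: R_def add_nonneg_pos)
  have R2: "(R \<epsilon> x)\<^sup>2 = (J x)\<^sup>2 + (\<nu> \<epsilon> x)\<^sup>2" for \<epsilon> x
    by (simp add: R_def)
  have \<nu>R: "\<nu> \<epsilon> x \<le> R \<epsilon> x" for \<epsilon> x
    unfolding R_def by (rule real_le_rsqrt) simp
  have JR: "\<bar>J x\<bar> \<le> R \<epsilon> x" for \<epsilon> x
    unfolding R_def by (rule real_le_rsqrt) simp
  have N\<nu>: "\<bar>N x\<bar> \<le> \<nu> \<epsilon> x" for \<epsilon> x
    unfolding \<nu>_def by (rule real_le_rsqrt) simp
  have d\<nu>: "(\<nu> \<epsilon> has_real_derivative N x * N' x / \<nu> \<epsilon> x) (at x)" if "\<epsilon> > 0" for \<epsilon> x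
    unfolding \<nu>_def using that \<nu>0[OF that, of x] unfolding \<nu>_def
    by (auto intro!: derivative_eq_intros dN simp: field_simps)
  have dR: "(R \<epsilon> has_real_derivative (J x * J' x + N x * N' x) / R \<epsilon> x) (at x)" if "\<epsilon> > 0" for \<epsilon> x
    unfolding R_def using R0[OF that, of x] \<nu>0[OF that, of x] unfolding R_def
    by (auto intro!: derivative_eq_intros dJ d\<nu>[OF that] simp: field_simps)
  have dG: "(G \<epsilon> has_real_derivative G' \<epsilon> x) (at x)" if "\<epsilon> > 0" for \<epsilon> x
  proof -
    let ?\<nu> = "\<nu> \<epsilon> x" and ?R = "R \<epsilon> x"
    let ?d = "N x * N' x / ?\<nu>"
    have "(G \<epsilon> has_real_derivative
        ((J' x * ?\<nu> + J x * ?d) * ?R - J x * ?\<nu> * ((J x * J' x + N x * N' x) / ?R)) / (?R * ?R)) (at x)"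
      unfolding G_def using R0[OF that, of x]
      by (auto intro!: derivative_eq_intros dJ d\<nu>[OF that] dR[OF that])
    also have "((J' x * ?\<nu> + J x * ?d) * ?R - J x * ?\<nu> * ((J x * J' x + N x * N' x) / ?R)) / (?R * ?R)
        = ((J' x * ?\<nu> + J x * ?d) * ?R\<^sup>2 - J x * ?\<nu> * (J x * J' x + ?\<nu> * ?d)) / ?R ^ 3"
      using R0[OF that, of x] \<nu>0[OF that, of x] by (simp add: field_simps power2_eq_square power3_eq_cube)
    also have "\<dots> = G' \<epsilon> x"
      unfolding R2 G'_def by (rule arg_cong2[where f = "(/)"]) (simp_all add: algebra_simps power2_eq_square power3_eq_cube)
    finally show ?thesis .
  qed
  have cN': "continuous_on UNIV N'"
    unfolding N'[abs_def] by (intro continuous_intros cg cJ cb)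
  have c\<nu>: "continuous_on UNIV (\<nu> \<epsilon>)" and cR: "continuous_on UNIV (R \<epsilon>)" for \<epsilon>
    unfolding \<nu>_def R_def by (intro continuous_intros cN cJ)+
  have cG': "continuous_on UNIV (G' \<epsilon>)" if "\<epsilon> > 0" for \<epsilon>
    unfolding G'_def using R0[OF that] \<nu>0[OF that]
    by (intro continuous_intros cN cJ cN' cJ' c\<nu> cR) (auto simp: less_imp_neq[symmetric])
  have ch: "continuous_on UNIV (h \<epsilon>)" if "\<epsilon> > 0" for \<epsilon>
    unfolding h_def using R0[OF that] \<nu>0[OF that]
    by (intro continuous_intros cN cJ cg c\<nu> cR) (auto simp: less_imp_neq[symmetric])
  have h0: "0 \<le> h \<epsilon> x" if "\<epsilon> > 0" for \<epsilon> x
    unfolding h_def using R0[OF that, of x] \<nu>0[OF that, of x]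
    by (intro divide_nonneg_nonneg mult_nonneg_nonneg[OF _ gN]) auto
  have hG: "h \<epsilon> x \<le> G' \<epsilon> x + (\<bar>J' x\<bar> + 2 * \<bar>b x\<bar>)" if "\<epsilon> > 0" for \<epsilon> x
  proof -
    have e: "G' \<epsilon> x = h \<epsilon> x + (J' x * (\<nu> \<epsilon> x / R \<epsilon> x)^3 + 2 * b x * ((J x / R \<epsilon> x)^3 * (N x / \<nu> \<epsilon> x)))"
      unfolding G'_def h_def N'[of x] using R0[OF that, of x] \<nu>0[OF that, of x]
      by (simp add: field_simps power_eq_if)
    have r1: "\<bar>\<nu> \<epsilon> x / R \<epsilon> x\<bar> \<le> 1" and r2: "\<bar>J x / R \<epsilon> x\<bar> \<le> 1" and r3: "\<bar>N x / \<nu> \<epsilon> x\<bar> \<le> 1"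
      using R0[OF that, of x] \<nu>0[OF that, of x] \<nu>R[of \<epsilon> x] JR[of x \<epsilon>] N\<nu>[of x \<epsilon>]
      by (auto simp: abs_divide divide_le_eq_1)
    have "\<bar>J' x * (\<nu> \<epsilon> x / R \<epsilon> x)^3\<bar> \<le> \<bar>J' x\<bar> * 1"
      unfolding abs_mult power_abs using r1 by (intro mult_left_mono power_le_one) auto
    moreover have "\<bar>(J x / R \<epsilon> x)^3 * (N x / \<nu> \<epsilon> x)\<bar> \<le> 1 * 1"
      unfolding abs_mult power_abs using r2 r3 by (intro mult_mono power_le_one) auto
    then have "\<bar>2 * b x * ((J x / R \<epsilon> x)^3 * (N x / \<nu> \<epsilon> x))\<bar> \<le> 2 * \<bar>b x\<bar> * 1"
      unfolding abs_mult[of "2 * b x"] by (intro mult_mono) auto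
    ultimately show ?thesis unfolding e by linarith
  qed
  have GB: "\<bar>G \<epsilon> x\<bar> \<le> B" if "\<epsilon> > 0" for \<epsilon> x
  proof -
    have "\<bar>G \<epsilon> x\<bar> = \<bar>J x\<bar> * (\<nu> \<epsilon> x / R \<epsilon> x)"
      unfolding G_def using R0[OF that, of x] \<nu>0[OF that, of x] by (simp add: abs_mult)
    also have "\<dots> \<le> B * 1"
      using R0[OF that, of x] \<nu>0[OF that, of x] \<nu>R[of \<epsilon> x] B[of x]
      by (intro mult_mono) (auto simp: divide_le_eq_1)
    finally show ?thesis by simp
  qed
  \<comment> \<open>\<open>K\<close> is independent of both \<epsilon> and \<open>k\<close>: the
    increment of \<open>G\<close> over any interval is at most \<open>2 * B\<close>.\<close>
  have int_h: "(\<integral>\<^sup>+x. ennreal (h \<epsilon> x * indicator {- k..k} x) \<partial>lborel) \<le> ennreal K" if "\<epsilon> > 0" "k > 0" for \<epsilon> k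
  proof -
    have i1: "has_bochner_integral lborel (\<lambda>x. G' \<epsilon> x * indicator {-k..k} x) (G \<epsilon> k - G \<epsilon> (-k))"
      using dG[OF that(1)] cG'[OF that(1)] that continuous_on_eq_continuous_at[of UNIV "G' \<epsilon>"]
      by (intro has_bochner_integral_FTC_Icc_real) auto
    have i2: "integrable lborel (\<lambda>x. \<bar>J' x\<bar> + 2 * \<bar>b x\<bar>)"
      using iJ' ib by auto
    have ih: "integrable lborel (\<lambda>x. h \<epsilon> x * indicator {-k..k} x)"
    proof -
      have "integrable lborel (\<lambda>x. indicator {-k..k} x *\<^sub>R h \<epsilon> x)"
        by (rule borel_integrable_compact) (auto intro: continuous_on_subset[OF ch[OF that(1)]])
      then show ?thesis by (simp add: mult.commute)
    qed
    have "(\<integral>x. h \<epsilon> x * indicator {-k..k} x \<partial>lborel)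
        \<le> (\<integral>x. G' \<epsilon> x * indicator {-k..k} x + (\<bar>J' x\<bar> + 2 * \<bar>b x\<bar>) \<partial>lborel)"
    proof (rule integral_mono[OF ih Bochner_Integration.integrable_add[OF _ i2]])
      show "integrable lborel (\<lambda>x. G' \<epsilon> x * indicator {-k..k} x)"
        using i1 by (simp add: has_bochner_integral_iff)
    qed (use hG[OF that(1)] in \<open>auto simp: indicator_def\<close>)
    also have "\<dots> = (G \<epsilon> k - G \<epsilon> (-k)) + (\<integral>x. \<bar>J' x\<bar> + 2 * \<bar>b x\<bar> \<partial>lborel)"
      using i1 by (subst Bochner_Integration.integral_add[OF _ i2]) (simp_all add: has_bochner_integral_iff)
    also have "\<dots> \<le> K"
      using GB[OF that(1), of k] GB[OF that(1), of "-k"] unfolding K_def by linarith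
    finally show ?thesis
      using ih h0[OF that(1)] by (subst nn_integral_eq_integral) (auto intro: ennreal_leI)
  qed
  define e where "e n = 1 / real (Suc n)" for n
  have e0: "e n > 0" for n by (simp add: e_def)
  have elim: "e \<longlonglongrightarrow> 0" unfolding e_def by (rule LIMSEQ_Suc[OF lim_1_over_n])
  define H where "H n x = h (e n) x * indicator {- real (Suc n)..real (Suc n)} x" for n x
  \<comment> \<open>The limit of \<open>h\<close> as \<epsilon> tends to 0. At a zero of
    \<open>N\<close> the numerator of \<open>h\<close> vanishes for every \<epsilon>, whence the
    value 0.\<close>
  define L where "L x = (if N x = 0 then 0 else 2 * (J x)^4 * (g x * N x) / (\<bar>N x\<bar> * sqrt ((J x)\<^sup>2 + (N x)\<^sup>2)^3))" for x
  have HL: "(\<lambda>n. H n x) \<longlonglongrightarrow> L x" for x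
  proof (cases "N x = 0")
    case True
    then show ?thesis by (simp add: H_def h_def L_def)
  next
    case False
    have \<nu>l: "(\<lambda>n. \<nu> (e n) x) \<longlonglongrightarrow> \<bar>N x\<bar>"
      using tendsto_real_sqrt[OF tendsto_add[OF tendsto_const[of "(N x)\<^sup>2"] tendsto_power[OF elim, of 2]]]
      unfolding \<nu>_def by simp
    have Rl: "(\<lambda>n. R (e n) x) \<longlonglongrightarrow> sqrt ((J x)\<^sup>2 + (N x)\<^sup>2)"
      using tendsto_real_sqrt[OF tendsto_add[OF tendsto_const[of "(J x)\<^sup>2"] tendsto_power[OF \<nu>l, of 2]]]
      unfolding R_def by simp
    have "sqrt ((J x)\<^sup>2 + (N x)\<^sup>2) \<noteq> 0" using False by (simp add: add_nonneg_eq_0_iff)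
    then have "(\<lambda>n. h (e n) x) \<longlonglongrightarrow> L x"
      unfolding h_def L_def using False
      by (auto intro!: tendsto_intros \<nu>l Rl)
    moreover have "\<forall>\<^sub>F n in sequentially. h (e n) x = H n x"
    proof -
      obtain m where "\<bar>x\<bar> < real m" using reals_Archimedean2 by blast
      then have "\<forall>n\<ge>m. h (e n) x = H n x" by (auto simp: H_def indicator_def)
      then show ?thesis by (auto simp: eventually_sequentially)
    qed
    ultimately show ?thesis by (rule Lim_transform_eventually)
  qed
  have Lm: "L \<in> borel_measurable borel"
  proof -
    have [measurable]: "N \<in> borel_measurable borel" "J \<in> borel_measurable borel" "g \<in> borel_measurable borel"
      using cN cJ cg by (auto intro: borel_measurable_continuous_onI)
    show ?thesis unfolding L_def by measurable
  qed
  have L0: "0 \<le> L x" for x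
    unfolding L_def by (auto intro!: divide_nonneg_nonneg mult_nonneg_nonneg[OF _ gN])
  \<comment> \<open>Fatou's lemma removes the regularisation and the cutoff together.\<close>
  have "(\<integral>\<^sup>+x. ennreal (L x) \<partial>lborel) = (\<integral>\<^sup>+x. liminf (\<lambda>n. ennreal (H n x)) \<partial>lborel)"
    using HL by (intro nn_integral_cong) (metis lim_imp_Liminf sequentially_bot tendsto_ennrealI)
  also have "\<dots> \<le> liminf (\<lambda>n. \<integral>\<^sup>+x. ennreal (H n x) \<partial>lborel)"
  proof (rule nn_integral_liminf)
    fix n
    have [measurable]: "h (e n) \<in> borel_measurable borel"
      using ch[OF e0] by (rule borel_measurable_continuous_onI)
    show "(\<lambda>x. ennreal (H n x)) \<in> borel_measurable lborel" unfolding H_def by measurable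
  qed
  also have "\<dots> \<le> liminf (\<lambda>n. ennreal K)"
    unfolding H_def by (intro Liminf_mono always_eventually allI int_h[OF e0]) simp
  also have "\<dots> = ennreal K" by (simp add: Liminf_const)
  finally have iL: "integrable lborel L"
    using Lm L0 by (intro integrableI_bounded) (auto simp: less_top[symmetric] top_unique)
  \<comment> \<open>If \<open>\<bar>N x\<bar> < \<bar>J x\<bar>\<close>, the square root in
    \<open>L\<close> is at most 3/2 of \<open>\<bar>J x\<bar>\<close> and its cube at most 6 times
    that of \<open>\<bar>J x\<bar>\<close>; so \<open>L x\<close> is at least a third of
    \<open>\<bar>g x * J x\<bar>\<close>.\<close>
  have bound: "\<bar>g x * J x\<bar> \<le> 3 * L x + \<bar>g x * N x\<bar> + \<bar>b x\<bar>" for x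
  proof -
    consider "N x = 0" | "N x \<noteq> 0" "\<bar>J x\<bar> \<le> \<bar>N x\<bar>" | "N x \<noteq> 0" "\<bar>N x\<bar> < \<bar>J x\<bar>" by linarith
    then show ?thesis
    proof cases
      case 1
      then show ?thesis using N0[of x] L0[of x] by linarith
    next
      case 2
      then have "\<bar>g x * J x\<bar> \<le> \<bar>g x * N x\<bar>"
        unfolding abs_mult by (intro mult_left_mono) auto
      then show ?thesis using L0[of x] by linarith
    next
      case 3
      let ?r = "sqrt ((J x)\<^sup>2 + (N x)\<^sup>2)"
      have J0: "\<bar>J x\<bar> > 0" using 3 by linarith
      have "(N x)\<^sup>2 \<le> (J x)\<^sup>2" using 3 abs_le_square_iff[of "N x" "J x"] by simp
      then have "?r \<le> sqrt ((3/2 * \<bar>J x\<bar>)\<^sup>2)"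
        by (intro real_sqrt_le_mono) (simp add: power2_eq_square, smt (verit) zero_le_square)
      then have "?r \<le> 3/2 * \<bar>J x\<bar>" by simp
      then have "?r ^ 3 \<le> (3/2 * \<bar>J x\<bar>) ^ 3" by (intro power_mono) auto
      also have "\<dots> = 27 / 8 * \<bar>J x\<bar> ^ 3" by (simp add: power_mult_distrib power_divide)
      also have "\<dots> \<le> 6 * \<bar>J x\<bar> ^ 3" by (intro mult_right_mono) auto
      finally have r: "?r ^ 3 \<le> 6 * \<bar>J x\<bar> ^ 3" .
      have r0: "?r > 0" using J0 by (simp add: add_pos_nonneg)
      have "g x * N x = \<bar>g x\<bar> * \<bar>N x\<bar>" using gN[of x] by (simp add: abs_mult[symmetric])
      then have "L x = 2 * \<bar>g x\<bar> * \<bar>J x\<bar>^4 / ?r ^ 3"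
        unfolding L_def using 3 by simp
      moreover have "\<bar>J x\<bar>^4 / ?r ^ 3 \<ge> \<bar>J x\<bar>^4 / (6 * \<bar>J x\<bar> ^ 3)"
        using r r0 J0 by (intro divide_left_mono mult_pos_pos zero_less_power) auto
      moreover have "\<bar>J x\<bar>^4 / (6 * \<bar>J x\<bar> ^ 3) = \<bar>J x\<bar> / 6"
        using J0 by (simp add: power_eq_if)
      ultimately have "L x \<ge> 2 * \<bar>g x\<bar> * (\<bar>J x\<bar> / 6)"
        by (metis (no_types, lifting) abs_ge_zero mult_left_mono mult_nonneg_nonneg times_divide_eq_right zero_le_numeral)
      then have "\<bar>g x * J x\<bar> \<le> 3 * L x" by (simp add: abs_mult mult.commute)
      then show ?thesis using abs_ge_zero[of "g x * N x"] abs_ge_zero[of "b x"] by linarith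
    qed
  qed
  have [measurable]: "J \<in> borel_measurable borel" "g \<in> borel_measurable borel"
    using cJ cg by (auto intro: borel_measurable_continuous_onI)
  show ?thesis
  proof (rule Bochner_Integration.integrable_bound)
    show "integrable lborel (\<lambda>x. 3 * L x + \<bar>g x * N x\<bar> + \<bar>b x\<bar>)" using iL iN ib by auto
    show "AE x in lborel. norm (g x * J x) \<le> norm (3 * L x + \<bar>g x * N x\<bar> + \<bar>b x\<bar>)"
      using bound by (auto intro!: AE_I2 order.trans[OF _ abs_ge_self])
  qed measurable
qed

section \<open>Integration by parts along a line of densities\<close>

text \<open>
  The densities proportional to \<open>exp (u + s * v)\<close> form a line in the family. The function squared
  in the last assumption is \<open>\<L>\<^sup>* p / p\<close> for such a density \<open>p\<close>: it is quadratic in \<open>s\<close>,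
  with coefficients \<open>rate 0\<close>, \<open>\<beta>\<close> and \<open>a v1\<^sup>2 / 2\<close>, and is minus the derivative of the
  probability flux divided by \<open>p\<close>.
\<close>

locale fp_line =
  fixes f f1 a a1 a2 u u1 u2 v v1 v2 :: "real \<Rightarrow> real"
  assumes df: "\<And>x. (f has_real_derivative f1 x) (at x)"
    and da: "\<And>x. (a has_real_derivative a1 x) (at x)"
    and da1: "\<And>x. (a1 has_real_derivative a2 x) (at x)"
    and du: "\<And>x. (u has_real_derivative u1 x) (at x)"
    and du1: "\<And>x. (u1 has_real_derivative u2 x) (at x)"
    and dv: "\<And>x. (v has_real_derivative v1 x) (at x)"
    and dv1: "\<And>x. (v1 has_real_derivative v2 x) (at x)"
    and cf1: "continuous_on UNIV f1" and ca2: "continuous_on UNIV a2"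
    and cu2: "continuous_on UNIV u2" and cv2: "continuous_on UNIV v2"
    and a0: "\<And>x. 0 \<le> a x"
    and int_exp: "\<And>s. s \<in> {-2, -1, 0, 1, 2} \<Longrightarrow> integrable lborel (\<lambda>x. exp (u x + s * v x))"
    and int_sq: "\<And>s. s \<in> {-2, -1, 0, 1, 2} \<Longrightarrow> integrable lborel (\<lambda>x.
      (- f1 x - f x * (u1 x + s * v1 x)
        + (a2 x + 2 * a1 x * (u1 x + s * v1 x) + a x * (u2 x + s * v2 x + (u1 x + s * v1 x)\<^sup>2)) / 2)\<^sup>2
      * exp (u x + s * v x))"
begin

definition w :: "real \<Rightarrow> real \<Rightarrow> real" where
  "w s x = exp (u x + s * v x)"

definition rate :: "real \<Rightarrow> real \<Rightarrow> real" where
  "rate s x = - f1 x - f x * (u1 x + s * v1 x)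
     + (a2 x + 2 * a1 x * (u1 x + s * v1 x) + a x * (u2 x + s * v2 x + (u1 x + s * v1 x)\<^sup>2)) / 2"

text \<open>The probability current f w - (a w)' / 2 of the unnormalised density \<open>w s\<close>,
  with the derivative expanded.\<close>

definition flux :: "real \<Rightarrow> real \<Rightarrow> real" where
  "flux s x = (f x - (a1 x + a x * (u1 x + s * v1 x)) / 2) * w s x"

definition \<beta> :: "real \<Rightarrow> real" where
  "\<beta> x = - f x * v1 x + a1 x * v1 x + a x * v2 x / 2 + a x * u1 x * v1 x"

text \<open>The rate at which the flux changes along the line, up to the factor - 1/2 and the tilt;
  see \<open>flux_shift\<close>.\<close>

definition N :: "real \<Rightarrow> real" where
  "N x = a x * w 0 x * v1 x"

text \<open>A single integrable majorant. Both signs of \<open>s\<close> are summed so that one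
  bound serves at every point, whatever the sign of \<open>v\<close>.\<close>

definition dominant :: "real \<Rightarrow> real" where
  "dominant x = (\<Sum>s\<in>{-2, -1, 0, 1, 2}. (1 + (rate s x)\<^sup>2) * w s x)"

lemma cont [continuous_intros]:
  "continuous_on A f" "continuous_on A f1" "continuous_on A a" "continuous_on A a1" "continuous_on A a2"
  "continuous_on A u" "continuous_on A u1" "continuous_on A u2"
  "continuous_on A v" "continuous_on A v1" "continuous_on A v2"
  using df da da1 du du1 dv dv1 continuous_on_subset[OF cf1] continuous_on_subset[OF ca2]
    continuous_on_subset[OF cu2] continuous_on_subset[OF cv2]
  by (auto intro!: continuous_at_imp_continuous_on DERIV_isCont)

lemma cont_derived [continuous_intros]:
  "continuous_on A (w s)" "continuous_on A (rate s)" "continuous_on A (flux s)"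
  "continuous_on A \<beta>" "continuous_on A N"
  unfolding flux_def[abs_def] w_def[abs_def] rate_def[abs_def] \<beta>_def[abs_def] N_def[abs_def]
  by (rule continuous_intros | simp)+

section \<open>Moment bounds under the central density of a line\<close>

lemma w_pos: "0 < w s x"
  by (simp add: w_def)

lemma integrable_w: "s \<in> {-2, -1, 0, 1, 2} \<Longrightarrow> integrable lborel (w s)"
  using int_exp unfolding w_def .

lemma integrable_dominant: "integrable lborel dominant"
  unfolding dominant_def
proof (rule Bochner_Integration.integrable_sum)
  fix s :: real assume s: "s \<in> {-2, -1, 0, 1, 2}"
  have "integrable lborel (\<lambda>x. (rate s x)\<^sup>2 * w s x)"
    using int_sq[OF s] by (simp only: rate_def w_def)
  then show "integrable lborel (\<lambda>x. (1 + (rate s x)\<^sup>2) * w s x)"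
    using integrable_w[OF s] by (simp add: distrib_right)
qed

lemma le_dominant: "s \<in> {-2, -1, 0, 1, 2} \<Longrightarrow> (1 + (rate s x)\<^sup>2) * w s x \<le> dominant x"
  unfolding dominant_def
  by (rule member_le_sum[of s _ "\<lambda>s. (1 + (rate s x)\<^sup>2) * w s x"])
    (auto intro!: mult_nonneg_nonneg less_imp_le[OF w_pos])

lemma dominant_nonneg: "0 \<le> dominant x"
  unfolding dominant_def using w_pos
  by (intro sum_nonneg mult_nonneg_nonneg) (auto intro: less_imp_le)

lemma integrable_of_le_dominant:
  assumes "continuous_on UNIV g" "\<And>x. \<bar>g x\<bar> \<le> K * dominant x"
  shows "integrable lborel g"
proof (rule Bochner_Integration.integrable_bound)
  show "integrable lborel (\<lambda>x. K * dominant x)"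
    using integrable_dominant by simp
  show "AE x in lborel. norm (g x) \<le> norm (K * dominant x)"
    using assms(2) by (auto intro!: AE_I2 order.trans[OF _ abs_ge_self])
qed (use assms(1) in \<open>simp add: borel_measurable_continuous_onI\<close>)

lemma flux_deriv: "(flux s has_real_derivative - (rate s x * w s x)) (at x)"
  unfolding flux_def w_def rate_def
  by (auto intro!: derivative_eq_intros df da da1 du du1 dv dv1
      simp: field_simps power2_eq_square)

lemma integrable_flux_deriv:
  assumes "s \<in> {-2, -1, 0, 1, 2}"
  shows "integrable lborel (\<lambda>x. - (rate s x * w s x))"
proof (rule integrable_of_le_dominant[where K = 1])
  fix x
  have "\<bar>rate s x\<bar> \<le> 1 + (rate s x)\<^sup>2"
    using sum_squares_bound[of "\<bar>rate s x\<bar>" 1] by simp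
  then have "\<bar>rate s x\<bar> * w s x \<le> (1 + (rate s x)\<^sup>2) * w s x"
    using w_pos by (intro mult_right_mono) (auto intro: less_imp_le)
  also have "\<dots> \<le> dominant x" by (rule le_dominant[OF assms])
  finally show "\<bar>- (rate s x * w s x)\<bar> \<le> 1 * dominant x"
    using w_pos[of s x] by (simp add: abs_mult)
qed (intro continuous_intros)

text \<open>Without its tilt the flux is affine in \<open>s\<close>, so its values at 0, s and 2s
  obey a linear relation. All boundary estimates rest on it.\<close>

lemma flux_shift: "flux s x = exp (s * v x) * (flux 0 x - s * N x / 2)"
  by (simp add: flux_def w_def N_def exp_add algebra_simps)

lemma rate_shift: "rate s x = rate 0 x + s * \<beta> x + s\<^sup>2 * (a x * (v1 x)\<^sup>2) / 2"
  by (simp add: rate_def \<beta>_def field_simps power2_eq_square)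

lemma w_shift: "w s x = exp (s * v x) * w 0 x"
  by (simp add: w_def exp_add)

text \<open>The sign of \<open>v x\<close> selects the half-line of \<open>s\<close> on which \<open>w s x \<ge> w 0 x\<close>.\<close>

lemma direction:
  obtains s :: real where "s \<in> {-1, 1}" "0 \<le> s * v x" "s * v x = \<bar>v x\<bar>"
proof (cases "0 \<le> v x")
  case True then show ?thesis using that[of 1] by simp
next
  case False then show ?thesis using that[of "-1"] by simp
qed

text \<open>The quadratic polynomial \<open>rate\<close> is interpolated at 0, s and 2s, with the
  sign of s chosen so that \<open>w s\<close> and \<open>w (2 * s)\<close> are at least
  \<open>w 0\<close>. The constants that arise are at most 19.5; 40 is a generous common
  value.\<close>

lemma sq_bounds:
  "(rate 0 x)\<^sup>2 * w 0 x \<le> 40 * dominant x"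
  "(\<beta> x)\<^sup>2 * w 0 x \<le> 40 * dominant x"
  "(a x * (v1 x)\<^sup>2)\<^sup>2 * w 0 x \<le> 40 * dominant x"
  "(1 + \<bar>v x\<bar>)\<^sup>2 * w 0 x \<le> 40 * dominant x"
proof -
  obtain s :: real where s: "s \<in> {-1, 1}" "0 \<le> s * v x" "s * v x = \<bar>v x\<bar>" by (rule direction)
  then have ss: "s * s = 1" "s\<^sup>2 = 1" by auto
  have mem: "s \<in> {-2, -1, 0, 1, 2}" "2 * s \<in> {-2, -1, 0, 1, 2}" using s by auto
  let ?q = "rate 0 x" and ?r = "rate s x" and ?t = "rate (2 * s) x" and ?g = "a x * (v1 x)\<^sup>2"
  have r: "?r = ?q + s * \<beta> x + ?g / 2" and t: "?t = ?q + 2 * (s * \<beta> x) + 2 * ?g"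
    unfolding rate_shift[of s] rate_shift[of "2 * s"] using ss by (simp_all add: power_mult_distrib)
  have g: "?g = ?t - 2 * ?r + ?q" and "s * \<beta> x = 2 * ?r - ?t / 2 - 3 / 2 * ?q"
    using r t by linarith+
  then have "(s * \<beta> x)\<^sup>2 = (2 * ?r - ?t / 2 - 3 / 2 * ?q)\<^sup>2" by simp
  then have b: "(\<beta> x)\<^sup>2 = (2 * ?r - ?t / 2 - 3 / 2 * ?q)\<^sup>2" using ss by (simp add: power_mult_distrib)
  have sq3: "(p + q + r)\<^sup>2 \<le> 3 * (p\<^sup>2 + q\<^sup>2 + r\<^sup>2)" for p q r :: real
    using sum_squares_bound[of p q] sum_squares_bound[of p r] sum_squares_bound[of q r]
    by (simp add: power2_eq_square algebra_simps)
  have g2: "?g\<^sup>2 \<le> 3 * (?t\<^sup>2 + 4 * ?r\<^sup>2 + ?q\<^sup>2)"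
    using sq3[of ?t "- 2 * ?r" ?q] unfolding g by (simp add: power_mult_distrib)
  have b2: "(\<beta> x)\<^sup>2 \<le> 3 * (4 * ?r\<^sup>2 + ?t\<^sup>2 / 4 + 9 / 4 * ?q\<^sup>2)"
    using sq3[of "2 * ?r" "- ?t / 2" "- 3 / 2 * ?q"] unfolding b by (simp add: power_mult_distrib power_divide)
  have w1: "w 0 x \<le> w s x" "w 0 x \<le> w (2 * s) x"
    using s(2) by (auto simp: w_def mult.assoc)
  have d: "\<rho>\<^sup>2 * w 0 x \<le> dominant x" if "\<rho> = rate \<sigma> x" "\<sigma> \<in> {-2, -1, 0, 1, 2}" "w 0 x \<le> w \<sigma> x" for \<rho> \<sigma>
  proof -
    have "\<rho>\<^sup>2 * w 0 x \<le> (1 + \<rho>\<^sup>2) * w \<sigma> x"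
      using that w_pos[of 0 x] by (intro mult_mono) auto
    then show ?thesis using le_dominant[OF that(2), of x] that(1) by simp
  qed
  have dq: "?q\<^sup>2 * w 0 x \<le> dominant x" and dr: "?r\<^sup>2 * w 0 x \<le> dominant x" and dt: "?t\<^sup>2 * w 0 x \<le> dominant x"
    using d[OF refl] mem w1 by auto
  show "(rate 0 x)\<^sup>2 * w 0 x \<le> 40 * dominant x"
    using dq dominant_nonneg[of x] by linarith
  have "(\<beta> x)\<^sup>2 * w 0 x \<le> 3 * (4 * ?r\<^sup>2 + ?t\<^sup>2 / 4 + 9 / 4 * ?q\<^sup>2) * w 0 x"
    using b2 w_pos[of 0 x] by (intro mult_right_mono) auto
  also have "\<dots> = 12 * (?r\<^sup>2 * w 0 x) + 3 / 4 * (?t\<^sup>2 * w 0 x) + 27 / 4 * (?q\<^sup>2 * w 0 x)"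
    by (simp add: algebra_simps)
  finally show "(\<beta> x)\<^sup>2 * w 0 x \<le> 40 * dominant x"
    using dq dr dt dominant_nonneg[of x] by linarith
  have "?g\<^sup>2 * w 0 x \<le> 3 * (?t\<^sup>2 + 4 * ?r\<^sup>2 + ?q\<^sup>2) * w 0 x"
    using g2 w_pos[of 0 x] by (intro mult_right_mono) auto
  also have "\<dots> = 12 * (?r\<^sup>2 * w 0 x) + 3 * (?t\<^sup>2 * w 0 x) + 3 * (?q\<^sup>2 * w 0 x)"
    by (simp add: algebra_simps)
  finally show "?g\<^sup>2 * w 0 x \<le> 40 * dominant x"
    using dq dr dt dominant_nonneg[of x] by linarith
  \<comment> \<open>Polynomial growth in \<open>v\<close> is paid for by the exponential tilt of the
    density at \<open>2 * s\<close>.\<close>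
  have "(1 + \<bar>v x\<bar>)\<^sup>2 \<le> (exp \<bar>v x\<bar>)\<^sup>2"
    by (intro power_mono exp_ge_add_one_self) auto
  also have "\<dots> = exp (2 * s * v x)"
    using s(3) by (simp add: exp_double mult.assoc)
  finally have "(1 + \<bar>v x\<bar>)\<^sup>2 * w 0 x \<le> w (2 * s) x"
    unfolding w_shift[of "2 * s"] using w_pos[of 0 x] by (intro mult_right_mono) auto
  also have "\<dots> \<le> (1 + ?t\<^sup>2) * w (2 * s) x"
    using w_pos[of "2 * s" x] by simp
  also have "\<dots> \<le> dominant x" by (rule le_dominant[OF mem(2)])
  finally show "(1 + \<bar>v x\<bar>)\<^sup>2 * w 0 x \<le> 40 * dominant x"
    using dominant_nonneg[of x] by linarith
qed

lemma integrable_prod: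
  assumes "continuous_on UNIV g" "continuous_on UNIV h"
    and "\<And>x. (g x)\<^sup>2 * w 0 x \<le> 40 * dominant x" "\<And>x. (h x)\<^sup>2 * w 0 x \<le> 40 * dominant x"
  shows "integrable lborel (\<lambda>x. g x * h x * w 0 x)"
proof (rule integrable_of_le_dominant[where K = 40])
  show "continuous_on UNIV (\<lambda>x. g x * h x * w 0 x)"
    by (intro continuous_intros assms)
  fix x
  have "2 * (\<bar>g x\<bar> * \<bar>h x\<bar>) \<le> (g x)\<^sup>2 + (h x)\<^sup>2"
    using sum_squares_bound[of "\<bar>g x\<bar>" "\<bar>h x\<bar>"] by simp
  then have "2 * (\<bar>g x\<bar> * \<bar>h x\<bar>) * w 0 x \<le> ((g x)\<^sup>2 + (h x)\<^sup>2) * w 0 x"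
    using w_pos[of 0 x] by (intro mult_right_mono) auto
  then show "\<bar>g x * h x * w 0 x\<bar> \<le> 40 * dominant x"
    using assms(3,4)[of x] w_pos[of 0 x] by (simp add: abs_mult distrib_right)
qed

lemma one_sq_bound: "(1::real)\<^sup>2 * w 0 x \<le> 40 * dominant x"
proof -
  have "1\<^sup>2 * w 0 x \<le> (1 + \<bar>v x\<bar>)\<^sup>2 * w 0 x"
    using w_pos[of 0 x] by (intro mult_right_mono power_mono) auto
  then show ?thesis using sq_bounds(4)[of x] by linarith
qed

lemma v_sq_bound: "(v x)\<^sup>2 * w 0 x \<le> 40 * dominant x"
proof -
  have "(v x)\<^sup>2 * w 0 x \<le> (1 + \<bar>v x\<bar>)\<^sup>2 * w 0 x"
    using w_pos[of 0 x] by (intro mult_right_mono) (auto simp: abs_le_square_iff[symmetric])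
  then show ?thesis using sq_bounds(4)[of x] by linarith
qed

lemma integrable_moments:
  "integrable lborel (\<lambda>x. rate 0 x * w 0 x)"
  "integrable lborel (\<lambda>x. \<beta> x * w 0 x)"
  "integrable lborel (\<lambda>x. a x * (v1 x)\<^sup>2 * w 0 x)"
  "integrable lborel (\<lambda>x. v x * rate 0 x * w 0 x)"
  using integrable_prod[of "\<lambda>x. 1" "rate 0"] integrable_prod[of "\<lambda>x. 1" \<beta>]
    integrable_prod[of "\<lambda>x. 1" "\<lambda>x. a x * (v1 x)\<^sup>2"] integrable_prod[of v "rate 0"]
  by (simp_all add: continuous_intros sq_bounds one_sq_bound[simplified] v_sq_bound)

section \<open>Boundary behaviour of the flux\<close>

lemma flux_bounds:
  defines "S \<equiv> \<lambda>x. \<Sum>s\<in>{-2, -1, 0, 1, 2}. \<bar>flux s x\<bar>"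
  shows "\<bar>v x * flux 0 x\<bar> \<le> 3 * S x" "\<bar>N x\<bar> \<le> 4 * S x"
proof -
  obtain s :: real where s: "s \<in> {-1, 1}" "0 \<le> s * v x" "s * v x = \<bar>v x\<bar>" by (rule direction)
  then have ss: "s * s = 1" by auto
  have mem: "s \<in> {-2, -1, 0, 1, 2}" "2 * s \<in> {-2, -1, 0, 1, 2}" using s by auto
  have le_S: "\<bar>flux r x\<bar> \<le> S x" if "r \<in> {-2, -1, 0, 1, 2}" for r
    unfolding S_def using that by (intro member_le_sum[of r _ "\<lambda>s. \<bar>flux s x\<bar>"]) auto
  let ?e = "exp (- \<bar>v x\<bar>)"
  \<comment> \<open>\<open>e1\<close> and \<open>e2\<close> are two linear equations for
    \<open>flux 0 x\<close> and \<open>s * N x\<close>, solved by twice the first minus the second,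
    and by twice their difference.\<close>
  have e1: "flux 0 x - s * N x / 2 = ?e * flux s x"
    unfolding flux_shift[of s] using s(3) by (simp add: exp_minus field_simps)
  have e2: "flux 0 x - s * N x = ?e * ?e * flux (2 * s) x"
    unfolding flux_shift[of "2 * s"] using s(3)
    by (simp add: mult.assoc[symmetric] exp_add[symmetric])
  have ee: "?e \<le> 1" "0 < ?e" by auto
  have b1: "\<bar>?e * flux s x\<bar> \<le> ?e * S x" 
    using le_S[OF mem(1)] by (simp add: abs_mult)
  have b2: "\<bar>?e * ?e * flux (2 * s) x\<bar> \<le> ?e * S x"
  proof -
    have "?e * ?e * \<bar>flux (2 * s) x\<bar> \<le> ?e * 1 * S x"
      using ee le_S[OF mem(2)] by (intro mult_mono mult_left_mono) auto
    then show ?thesis by (simp add: abs_mult)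
  qed
  have "\<bar>flux 0 x\<bar> \<le> 3 * (?e * S x)"
    using e1 e2 b1 b2 by linarith
  have S0: "0 \<le> S x" unfolding S_def by (intro sum_nonneg) auto
  have "?e * S x \<le> S x" using ee S0 by (simp add: mult_left_le_one_le)
  have "\<bar>s * N x\<bar> \<le> 4 * S x"
    using e1 e2 b1 b2 \<open>?e * S x \<le> S x\<close> by linarith
  then show "\<bar>N x\<bar> \<le> 4 * S x" using s(1) by auto
  \<comment> \<open>The decaying factor kept in the bound for \<open>flux 0 x\<close> absorbs the
    growth of \<open>v x\<close>.\<close>
  have "\<bar>v x\<bar> * \<bar>flux 0 x\<bar> \<le> \<bar>v x\<bar> * (3 * (?e * S x))"
    using \<open>\<bar>flux 0 x\<bar> \<le> 3 * (?e * S x)\<close> by (intro mult_left_mono) auto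
  also have "\<dots> = (\<bar>v x\<bar> * ?e) * (3 * S x)" by simp
  also have "\<dots> \<le> 1 * (3 * S x)"
  proof (rule mult_right_mono)
    have "\<bar>v x\<bar> \<le> exp \<bar>v x\<bar>" using exp_ge_add_one_self[of "\<bar>v x\<bar>"] by linarith
    then show "\<bar>v x\<bar> * ?e \<le> 1" by (simp add: exp_minus field_simps)
  qed (use S0 in simp)
  finally show "\<bar>v x * flux 0 x\<bar> \<le> 3 * S x" by (simp add: abs_mult)
qed

lemma flux_limit:
  assumes "s \<in> {-2, -1, 0, 1, 2}"
  shows "\<exists>L. (flux s \<longlongrightarrow> L) at_top" "\<exists>L. (flux s \<longlongrightarrow> L) at_bot"
  using convergent_at_top_of_integrable_deriv[OF flux_deriv _ integrable_flux_deriv[OF assms]]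
    convergent_at_bot_of_integrable_deriv[OF flux_deriv _ integrable_flux_deriv[OF assms]]
  by (auto simp: continuous_intros)

text \<open>
  Moving along the family towards the origin multiplies the density by \<open>exp (- s * v)\<close>, which is
  large where \<open>w 0\<close> is small. As the flux stays bounded there, the flux of \<open>w 0\<close> itself
  can only tend to a nonzero limit if \<open>w 0\<close> is bounded below, hence not integrable.
\<close>

lemma flux_limit_eq_0:
  assumes v: "\<And>x. v x = - \<epsilon> * u x" and "\<epsilon> > 0"
    and F: "F = at_top \<or> F = at_bot"
  shows "(flux 0 \<longlongrightarrow> 0) F"
proof -
  obtain L where L: "(flux 0 \<longlongrightarrow> L) F" using F flux_limit[of 0] by auto
  obtain L1 where L1: "(flux 1 \<longlongrightarrow> L1) F" using F flux_limit[of 1] by auto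
  obtain L2 where L2: "(flux 2 \<longlongrightarrow> L2) F" using F flux_limit[of 2] by auto
  have "L = 0"
  proof (rule ccontr)
    assume "L \<noteq> 0"
    \<comment> \<open>The second difference in \<open>s\<close> of the affine expression in
      \<open>flux_shift\<close> is zero.\<close>
    have J: "flux 0 x = 2 * exp (- v x) * flux 1 x - exp (- 2 * v x) * flux 2 x" for x
      unfolding flux_shift[of 1] flux_shift[of 2] by (simp add: exp_minus field_simps)
    define B where "B = \<bar>L1\<bar> + \<bar>L2\<bar> + 1"
    have "B > 0" by (simp add: B_def add_nonneg_pos)
    \<comment> \<open>If \<open>exp (- v x)\<close> were below \<open>k\<close>, the formula for
      \<open>flux 0 x\<close> would give at most \<open>3 * k * B\<close>, hence at most half of
      \<open>\<bar>L\<bar>\<close>.\<close>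
    define k where "k = min 1 (\<bar>L\<bar> / (6 * B))"
    have k: "0 < k" "k \<le> 1" "k \<le> \<bar>L\<bar> / (6 * B)" using \<open>L \<noteq> 0\<close> \<open>B > 0\<close> by (auto simp: k_def)
    have "\<forall>\<^sub>F x in F. \<bar>L\<bar> / 2 < \<bar>flux 0 x\<bar>"
      using order_tendstoD(1)[OF tendsto_rabs[OF L], of "\<bar>L\<bar> / 2"] \<open>L \<noteq> 0\<close> by simp
    moreover have "\<forall>\<^sub>F x in F. \<bar>flux 1 x\<bar> < B"
      using order_tendstoD(2)[OF tendsto_rabs[OF L1], of B] by (simp add: B_def)
    moreover have "\<forall>\<^sub>F x in F. \<bar>flux 2 x\<bar> < B"
      using order_tendstoD(2)[OF tendsto_rabs[OF L2], of B] by (simp add: B_def)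
    ultimately have "\<forall>\<^sub>F x in F. k powr (1 / \<epsilon>) \<le> w 0 x"
    proof eventually_elim
      case (elim x)
      let ?y = "exp (- v x)"
      have "k \<le> ?y"
      proof (rule ccontr)
        assume "\<not> k \<le> ?y"
        then have y: "?y < k" "?y \<le> 1" using k(2) by linarith+
        have "flux 0 x = 2 * ?y * flux 1 x - ?y * ?y * flux 2 x"
          unfolding J by (simp add: exp_add[symmetric])
        then have "\<bar>flux 0 x\<bar> \<le> 2 * ?y * \<bar>flux 1 x\<bar> + ?y * ?y * \<bar>flux 2 x\<bar>"
          using abs_triangle_ineq4[of "2 * ?y * flux 1 x" "?y * ?y * flux 2 x"] by (simp add: abs_mult)
        also have "\<dots> \<le> 2 * ?y * B + ?y * 1 * B"
          using elim y by (intro add_mono mult_mono mult_left_mono) auto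
        also have "\<dots> = 3 * (?y * B)" by simp
        also have "\<dots> < 3 * (k * B)" using y \<open>B > 0\<close> by simp
        also have "\<dots> \<le> 3 * (\<bar>L\<bar> / (6 * B) * B)" using k \<open>B > 0\<close> by (intro mult_left_mono mult_right_mono) auto
        also have "\<dots> = \<bar>L\<bar> / 2" using \<open>B > 0\<close> by simp
        finally show False using elim by simp
      qed
      \<comment> \<open>Because \<open>v\<close> is \<open>- \<epsilon> * u\<close>, the density
        \<open>w 0\<close> is the power \<open>1 / \<epsilon>\<close> of
        \<open>exp (- v x)\<close>.\<close>
      then have "k powr (1 / \<epsilon>) \<le> ?y powr (1 / \<epsilon>)"
        using k \<open>\<epsilon> > 0\<close> by (intro powr_mono2) auto
      also have "\<dots> = w 0 x" using \<open>\<epsilon> > 0\<close> by (simp add: w_def v powr_def)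
      finally show ?case .
    qed
    then show False
      using F k(1) w_pos[of 0] not_integrable_at_top_of_lower_bound[OF integrable_w[of 0], of "k powr (1 / \<epsilon>)"]
        not_integrable_at_bot_of_lower_bound[OF integrable_w[of 0], of "k powr (1 / \<epsilon>)"]
      by (auto simp: less_imp_le)
  qed
  then show ?thesis using L by simp
qed

section \<open>Integrability and integral of the generator\<close>

lemma N_deriv:
  "(N has_real_derivative 2 * (v1 x * flux 0 x + \<beta> x * w 0 x)) (at x)"
  unfolding N_def flux_def \<beta>_def w_def
  by (auto intro!: derivative_eq_intros da du dv dv1 simp: field_simps)

text \<open>The sign coupling is \<open>N = (a * w 0) * v1\<close> with \<open>a\<close>
  nonnegative; \<open>v1 * N\<close> is, up to a factor 2, the quadratic coefficient of
  \<open>rate\<close> times \<open>w 0\<close>, hence integrable.\<close>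

lemma integrable_flux_mult: "integrable lborel (\<lambda>x. v1 x * flux 0 x)"
proof (rule integrable_mult_of_sign_coupling[where J = "flux 0" and N = N and \<kappa> = "\<lambda>x. a x * w 0 x"
      and b = "\<lambda>x. \<beta> x * w 0 x", OF flux_deriv _ N_deriv _ _ dv1])
  show "((\<lambda>x. a x * w 0 x) has_real_derivative (a1 x + a x * u1 x) * w 0 x) (at x)" for x
    unfolding w_def by (auto intro!: derivative_eq_intros da du dv simp: field_simps)
  show "integrable lborel (\<lambda>x. v1 x * N x)"
    using integrable_moments(3) by (simp add: N_def power2_eq_square mult_ac)
  show "0 \<le> a x * w 0 x" for x
    by (intro mult_nonneg_nonneg a0 less_imp_le[OF w_pos])
  show "integrable lborel (\<lambda>x. - (rate 0 x * w 0 x))"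
    by (rule integrable_flux_deriv) simp
qed (simp add: N_def | intro refl integrable_moments continuous_intros)+

text \<open>Splits the integrand into the exact derivative from \<open>N_deriv\<close> and a moment
  that is already known to be integrable.\<close>

lemma generator_eq:
  "(f x * v1 x + a x * v2 x / 2) * w 0 x = 2 * (v1 x * flux 0 x + \<beta> x * w 0 x) - \<beta> x * w 0 x"
  unfolding flux_def \<beta>_def by (simp add: field_simps)

lemma integrable_generator: "integrable lborel (\<lambda>x. (f x * v1 x + a x * v2 x / 2) * w 0 x)"
  unfolding generator_eq
  by (intro Bochner_Integration.integrable_diff integrable_mult_right
      Bochner_Integration.integrable_add integrable_flux_mult integrable_moments)

text \<open>\<open>flux_limit_eq_0\<close> covers only tilts proportional to \<open>u\<close>. For
  other directions the vanishing is assumed here; \<open>weak_form\<close> supplies it from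
  \<open>flux_vanishes\<close>.\<close>

context
  assumes flux_0: "\<And>s F. s \<in> {-2, -1, 0, 1, 2} \<Longrightarrow> F = at_top \<or> F = at_bot \<Longrightarrow> (flux s \<longlongrightarrow> 0) F"
begin

lemma boundary_0:
  assumes F: "F = at_top \<or> F = at_bot"
  shows "(N \<longlongrightarrow> 0) F" "((\<lambda>x. v x * flux 0 x) \<longlongrightarrow> 0) F"
proof -
  have S: "((\<lambda>x. \<Sum>s\<in>{-2, -1, 0, 1, 2}. \<bar>flux s x\<bar>) \<longlongrightarrow> (\<Sum>s\<in>{-2, -1, 0, 1, 2 :: real}. \<bar>0\<bar>)) F"
    by (intro tendsto_sum tendsto_rabs flux_0 F)
  show "(N \<longlongrightarrow> 0) F"
    using flux_bounds(2) tendsto_mult_left[OF S, of 4]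
    by (intro Lim_null_comparison[of N]) (auto intro!: always_eventually)
  show "((\<lambda>x. v x * flux 0 x) \<longlongrightarrow> 0) F"
    using flux_bounds(1) tendsto_mult_left[OF S, of 3]
    by (intro Lim_null_comparison[of "\<lambda>x. v x * flux 0 x"]) (auto intro!: always_eventually)
qed

lemma integral_rate: "(\<integral>x. rate 0 x * w 0 x \<partial>lborel) = 0"
  using integral_deriv_eq_0[OF flux_deriv _ integrable_flux_deriv, of 0] flux_0[of 0]
  by (auto simp: continuous_intros)

text \<open>Both sides are minus the integral of \<open>\<beta> * w 0\<close>: on the left because
  the derivative of \<open>N\<close> integrates to 0, on the right because
  \<open>N / 2 - v * flux 0\<close> is a primitive of the sum, in which the terms
  \<open>v1 * flux 0\<close> cancel.\<close>

lemma integral_generator: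
  "(\<integral>x. (f x * v1 x + a x * v2 x / 2) * w 0 x \<partial>lborel) = (\<integral>x. v x * rate 0 x * w 0 x \<partial>lborel)"
proof -
  have iN: "integrable lborel (\<lambda>x. 2 * (v1 x * flux 0 x + \<beta> x * w 0 x))"
    by (intro integrable_mult_right Bochner_Integration.integrable_add integrable_flux_mult integrable_moments)
  have N: "(\<integral>x. 2 * (v1 x * flux 0 x + \<beta> x * w 0 x) \<partial>lborel) = 0"
    using boundary_0(1) by (intro integral_deriv_eq_0[OF N_deriv _ iN] continuous_intros) auto
  have b: "(\<integral>x. \<beta> x * w 0 x + v x * rate 0 x * w 0 x \<partial>lborel) = 0"
  proof (rule integral_deriv_eq_0)
    show "((\<lambda>x. N x / 2 - v x * flux 0 x) has_real_derivative
        \<beta> x * w 0 x + v x * rate 0 x * w 0 x) (at x)" for x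
      by (auto intro!: derivative_eq_intros N_deriv flux_deriv dv simp: field_simps)
    have "((\<lambda>x. N x / 2 - v x * flux 0 x) \<longlongrightarrow> 0 / 2 - 0) F" if "F = at_top \<or> F = at_bot" for F
      by (intro tendsto_diff tendsto_divide tendsto_const boundary_0 that) simp
    then show "((\<lambda>x. N x / 2 - v x * flux 0 x) \<longlongrightarrow> 0) at_top"
      "((\<lambda>x. N x / 2 - v x * flux 0 x) \<longlongrightarrow> 0) at_bot" by auto
  qed (intro continuous_intros Bochner_Integration.integrable_add integrable_moments)+
  have "(\<integral>x. (f x * v1 x + a x * v2 x / 2) * w 0 x \<partial>lborel) = 0 - (\<integral>x. \<beta> x * w 0 x \<partial>lborel)"
    using Bochner_Integration.integral_diff[OF iN integrable_moments(2)] unfolding generator_eq N .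
  also have "\<dots> = (\<integral>x. v x * rate 0 x * w 0 x \<partial>lborel)"
    using b by (subst (asm) Bochner_Integration.integral_add) (auto intro: integrable_moments)
  finally show ?thesis .
qed

end

end

section \<open>The norm of the exponential coordinate space\<close>

text \<open>Convexity of exp, averaged over \<open>z\<close> and \<open>- z\<close>. Shrinking the
  argument thus brings a finite mean of cosh - 1 below the threshold 1 of the Luxemburg
  norm.\<close>

lemma cosh_scaled_le:
  fixes z :: real
  assumes "0 \<le> \<kappa>" "\<kappa> \<le> 1"
  shows "cosh (\<kappa> * z) - 1 \<le> \<kappa> * (cosh z - 1)"
proof -
  have "exp (\<kappa> * z) \<le> (1 - \<kappa>) + \<kappa> * exp z" for z :: real
    using convex_onD[OF exp_convex assms, of 0 z] by simp
  from this[of z] this[of "- z"] show ?thesis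
    by (simp add: cosh_field_def field_simps)
qed

text \<open>Adding exp x \<ge> 1 + x + x^2 / 2 and exp (- x) \<ge> 1 - x cancels the linear terms.
  The estimate compares the Luxemburg norm with the L^2 norm.\<close>

lemma cosh_quadratic_lower: "x\<^sup>2 \<le> 4 * (cosh x - 1)" for x :: real
proof -
  have *: "x\<^sup>2 \<le> 4 * (cosh x - 1)" if "0 \<le> x" for x :: real
    using exp_lower_Taylor_quadratic[OF that] exp_ge_add_one_self[of "- x"]
    unfolding cosh_field_def by (simp add: add_divide_distrib)
  from *[of "\<bar>x\<bar>"] show ?thesis by simp
qed

lemma has_vector_derivative_iff_quotient:
  "(\<theta> has_vector_derivative D) (at t within I) \<longleftrightarrow>
     ((\<lambda>s. norm ((\<theta> s - \<theta> t) /\<^sub>R (s - t) - D)) \<longlongrightarrow> 0) (at t within I)"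
proof -
  have "norm (\<theta> s - \<theta> t - (s - t) *\<^sub>R D) / norm (s - t) = norm ((\<theta> s - \<theta> t) /\<^sub>R (s - t) - D)"
    if "s \<noteq> t" for s
  proof -
    have "(\<theta> s - \<theta> t) /\<^sub>R (s - t) - D = (\<theta> s - \<theta> t - (s - t) *\<^sub>R D) /\<^sub>R (s - t)"
      using that by (simp add: scaleR_diff_right)
    then show ?thesis by (simp add: divide_inverse mult.commute)
  qed
  then have "\<forall>\<^sub>F s in at t within I. norm (\<theta> s - \<theta> t - (s - t) *\<^sub>R D) / norm (s - t)
      = norm ((\<theta> s - \<theta> t) /\<^sub>R (s - t) - D)"
    by (auto simp: eventually_at_filter)
  then show ?thesis
    unfolding has_vector_derivative_def has_derivative_iff_norm
    by (simp add: bounded_linear_scaleR_left tendsto_cong)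
qed

locale em_point =
  fixes c :: "real \<Rightarrow> real^'m" and \<Theta> :: "(real^'m) set" and \<eta> :: "real^'m"
  assumes family: "exponential_family c \<Theta>" and \<eta>: "\<eta> \<in> \<Theta>"
    and cont_c: "\<And>i. continuous_on UNIV (\<lambda>x. c x $ i)"
begin

abbreviation P :: "real measure" where "P \<equiv> dens_measure (em_density c \<eta>)"
abbreviation y :: "real \<Rightarrow> real^'m" where "y \<equiv> em_centred c \<eta>"

lemma measurable_c [measurable]: "(\<lambda>x. c x $ i) \<in> borel_measurable borel"
  using cont_c by (rule borel_measurable_continuous_onI)

lemma measurable_inner_c [measurable]: "(\<lambda>x. \<zeta> \<bullet> c x) \<in> borel_measurable borel"
  unfolding inner_vec_def by measurable

lemma measurable_density [measurable]: "em_density c \<zeta> \<in> borel_measurable borel"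
  unfolding em_density_def[abs_def] by measurable

lemma measurable_centred [measurable]: "(\<lambda>x. y x $ i) \<in> borel_measurable borel"
  unfolding em_centred_def by (simp, measurable)

lemma measurable_inner_centred [measurable]: "(\<lambda>x. y x \<bullet> \<zeta>) \<in> borel_measurable borel"
  unfolding inner_vec_def by measurable

lemma sets_P [simp, measurable_cong]: "sets P = sets borel"
  by (simp add: dens_measure_def)

lemma space_P [simp]: "space P = UNIV"
  by (simp add: dens_measure_def)

sublocale prob_space P
  using family \<eta> by (simp add: exponential_family_def)

text \<open>The normalising factor is a positive constant, so integrability can be tested with the
  unnormalised weight of \<open>fp_line\<close>.\<close>

lemma integrable_P_iff:
  fixes h :: "real \<Rightarrow> real"
  assumes [measurable]: "h \<in> borel_measurable borel"
  shows "integrable (dens_measure (em_density c \<zeta>)) h \<longleftrightarrow> integrable lborel (\<lambda>x. h x * exp (\<zeta> \<bullet> c x))"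
proof -
  have "integrable (dens_measure (em_density c \<zeta>)) h \<longleftrightarrow>
      integrable lborel (\<lambda>x. em_density c \<zeta> x * h x)"
    unfolding dens_measure_def by (subst integrable_density) (auto simp: em_density_def)
  also have "(\<lambda>x. em_density c \<zeta> x * h x) =
      (\<lambda>x. exp (- log_partition c \<zeta>) * (h x * exp (\<zeta> \<bullet> c x)))"
    by (simp add: em_density_def exp_diff exp_minus field_simps)
  finally show ?thesis by simp
qed

lemma expect_eq:
  assumes [measurable]: "h \<in> borel_measurable borel"
  shows "expect (em_density c \<zeta>) h = exp (- log_partition c \<zeta>) * (\<integral>x. h x * exp (\<zeta> \<bullet> c x) \<partial>lborel)"
proof -
  have "expect (em_density c \<zeta>) h = (\<integral>x. em_density c \<zeta> x * h x \<partial>lborel)"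
    unfolding expect_def dens_measure_def by (subst integral_density) (auto simp: em_density_def)
  also have "(\<lambda>x. em_density c \<zeta> x * h x) =
      (\<lambda>x. exp (- log_partition c \<zeta>) * (h x * exp (\<zeta> \<bullet> c x)))"
    by (simp add: em_density_def exp_diff exp_minus field_simps)
  finally show ?thesis by simp
qed

section \<open>Exponential moments of the statistics\<close>

lemma integrable_exp:
  assumes "\<zeta> \<in> \<Theta>"
  shows "integrable lborel (\<lambda>x. exp (\<zeta> \<bullet> c x))"
proof -
  have "prob_space (dens_measure (em_density c \<zeta>))"
    using family assms by (simp add: exponential_family_def)
  then have "integrable (dens_measure (em_density c \<zeta>)) (\<lambda>_. 1 :: real)"
    by (intro finite_measure.integrable_const prob_space.axioms(1))
  then show ?thesis
    by (subst (asm) integrable_P_iff) simp_all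
qed

text \<open>The sum is at most \<open>m\<close> times its largest term, so its exponential is
  dominated by those of \<open>\<epsilon> * m\<close> times plus or minus each coordinate. Each of
  these shifts the parameter along an axis by less than the radius \<open>r\<close> of a ball in
  \<open>\<Theta>\<close>.\<close>

lemma exp_moment_c: "\<exists>\<epsilon>>0. integrable P (\<lambda>x. exp (\<epsilon> * (\<Sum>i\<in>UNIV. \<bar>c x $ i\<bar>)))"
proof -
  obtain r where r: "r > 0" "ball \<eta> r \<subseteq> \<Theta>"
    using family \<eta> by (auto simp: exponential_family_def open_contains_ball)
  define m where "m = real CARD('m)"
  have m: "m > 0" by (simp add: m_def)
  define \<epsilon> where "\<epsilon> = r / (2 * m)"
  have \<epsilon>: "\<epsilon> > 0" "\<epsilon> * m < r" "\<epsilon> * m > 0" using r m by (auto simp: \<epsilon>_def field_simps)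
  have int: "integrable P (\<lambda>x. exp (s * (c x $ i)))" if "\<bar>s\<bar> < r" for s i
  proof -
    have "\<eta> + s *\<^sub>R axis i 1 \<in> \<Theta>" using r that by (auto simp: dist_norm norm_axis_1)
    from integrable_exp[OF this] show ?thesis
      by (subst integrable_P_iff) (simp_all add: inner_add_left inner_axis' exp_add mult.commute)
  qed
  let ?B = "\<lambda>x. \<Sum>i\<in>UNIV. exp (\<epsilon> * m * (c x $ i)) + exp (- (\<epsilon> * m) * (c x $ i))"
  have "integrable P (\<lambda>x. exp (\<epsilon> * (\<Sum>i\<in>UNIV. \<bar>c x $ i\<bar>)))"
  proof (rule Bochner_Integration.integrable_bound)
    show "integrable P ?B"
      using \<epsilon> by (intro Bochner_Integration.integrable_sum Bochner_Integration.integrable_add int) auto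
    show "AE x in P. norm (exp (\<epsilon> * (\<Sum>i\<in>UNIV. \<bar>c x $ i\<bar>))) \<le> norm (?B x)"
    proof (rule AE_I2)
      fix x
      obtain k where k: "\<And>i. \<bar>c x $ i\<bar> \<le> \<bar>c x $ k\<bar>"
      proof -
        have "Max (range (\<lambda>i. \<bar>c x $ i\<bar>)) \<in> range (\<lambda>i. \<bar>c x $ i\<bar>)" by (intro Max_in) auto
        then obtain k where "Max (range (\<lambda>i. \<bar>c x $ i\<bar>)) = \<bar>c x $ k\<bar>" by (rule imageE)
        then have "\<bar>c x $ i\<bar> \<le> \<bar>c x $ k\<bar>" for i by (metis Max_ge finite finite_imageI rangeI)
        then show ?thesis by (rule that)
      qed
      have "(\<Sum>i\<in>UNIV. \<bar>c x $ i\<bar>) \<le> m * \<bar>c x $ k\<bar>"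
        using sum_bounded_above[of UNIV "\<lambda>i. \<bar>c x $ i\<bar>"] k by (simp add: m_def)
      then have "exp (\<epsilon> * (\<Sum>i\<in>UNIV. \<bar>c x $ i\<bar>)) \<le> exp (\<epsilon> * (m * \<bar>c x $ k\<bar>))"
        using \<epsilon> by simp
      also have "\<dots> \<le> exp (\<epsilon> * m * (c x $ k)) + exp (- (\<epsilon> * m) * (c x $ k))"
        by (cases "0 \<le> c x $ k") (auto simp: mult.assoc)
      also have "\<dots> \<le> ?B x"
        by (rule member_le_sum[of k UNIV "\<lambda>i. exp (\<epsilon> * m * (c x $ i)) + exp (- (\<epsilon> * m) * (c x $ i))"])
          (auto intro: add_nonneg_nonneg)
      finally show "norm (exp (\<epsilon> * (\<Sum>i\<in>UNIV. \<bar>c x $ i\<bar>))) \<le> norm (?B x)"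
        by (auto intro: order.trans[OF _ abs_ge_self])
    qed
  qed measurable
  then show ?thesis using \<epsilon> by blast
qed

definition Y :: "real \<Rightarrow> real" where "Y x = (\<Sum>i\<in>UNIV. \<bar>y x $ i\<bar>)"

lemma measurable_Y [measurable]: "Y \<in> borel_measurable borel"
  unfolding Y_def[abs_def] by measurable

lemma Y_nonneg: "0 \<le> Y x"
  by (simp add: Y_def sum_nonneg)

lemma inner_le_Y: "\<bar>y x \<bullet> u\<bar> \<le> norm u * Y x"
proof -
  have "\<bar>y x \<bullet> u\<bar> \<le> (\<Sum>i\<in>UNIV. \<bar>y x $ i * u $ i\<bar>)"
    unfolding inner_vec_def by (simp add: sum_abs)
  also have "\<dots> \<le> (\<Sum>i\<in>UNIV. norm u * \<bar>y x $ i\<bar>)"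
    by (intro sum_mono) (simp add: abs_mult component_le_norm_cart mult.commute[of "norm u"] mult_left_mono)
  finally show ?thesis by (simp add: Y_def sum_distrib_left)
qed

text \<open>One exponential moment is fixed, so that later integrability claims are comparisons with
  \<open>exp (\<epsilon> * Y x)\<close>.\<close>

definition \<epsilon> :: real where "\<epsilon> = (SOME \<epsilon>. \<epsilon> > 0 \<and> integrable P (\<lambda>x. exp (\<epsilon> * (\<Sum>i\<in>UNIV. \<bar>c x $ i\<bar>))))"

lemma \<epsilon>_pos: "\<epsilon> > 0"
  and exp_moment: "integrable P (\<lambda>x. exp (\<epsilon> * Y x))"
proof -
  have *: "\<epsilon> > 0 \<and> integrable P (\<lambda>x. exp (\<epsilon> * (\<Sum>i\<in>UNIV. \<bar>c x $ i\<bar>)))"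
    unfolding \<epsilon>_def by (rule someI_ex) (use exp_moment_c in blast)
  then show "\<epsilon> > 0" by simp
  let ?K = "\<Sum>i\<in>UNIV. \<bar>em_expect c \<eta> (\<lambda>x. c x $ i)\<bar>"
  have Y: "Y x \<le> (\<Sum>i\<in>UNIV. \<bar>c x $ i\<bar>) + ?K" for x
    unfolding Y_def sum.distrib[symmetric] by (intro sum_mono) (simp add: em_centred_def)
  show "integrable P (\<lambda>x. exp (\<epsilon> * Y x))"
  proof (rule Bochner_Integration.integrable_bound)
    show "integrable P (\<lambda>x. exp (\<epsilon> * ?K) * exp (\<epsilon> * (\<Sum>i\<in>UNIV. \<bar>c x $ i\<bar>)))"
      using * by simp
    show "AE x in P. norm (exp (\<epsilon> * Y x)) \<le> norm (exp (\<epsilon> * ?K) * exp (\<epsilon> * (\<Sum>i\<in>UNIV. \<bar>c x $ i\<bar>)))"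
    proof (rule AE_I2)
      fix x
      have "\<epsilon> * Y x \<le> \<epsilon> * ?K + \<epsilon> * (\<Sum>i\<in>UNIV. \<bar>c x $ i\<bar>)"
        using mult_left_mono[OF Y[of x], of \<epsilon>] * by (simp add: distrib_left)
      then show "norm (exp (\<epsilon> * Y x)) \<le> norm (exp (\<epsilon> * ?K) * exp (\<epsilon> * (\<Sum>i\<in>UNIV. \<bar>c x $ i\<bar>)))"
        by (simp add: exp_add[symmetric])
    qed
  qed measurable
qed

lemma integrable_exp_bound:
  assumes [measurable]: "h \<in> borel_measurable borel" and "\<And>x. \<bar>h x\<bar> \<le> K * exp (\<epsilon> * Y x)"
  shows "integrable P h"
proof (rule Bochner_Integration.integrable_bound)
  show "integrable P (\<lambda>x. K * exp (\<epsilon> * Y x))" using exp_moment by simp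
  show "AE x in P. norm (h x) \<le> norm (K * exp (\<epsilon> * Y x))"
    using assms(2) by (auto intro!: AE_I2 order.trans[OF _ abs_ge_self])
qed measurable

lemma integrable_Y: "integrable P Y" and integrable_Y_sq: "integrable P (\<lambda>x. (Y x)\<^sup>2)"
proof -
  have q: "1 + \<epsilon> * Y x + (\<epsilon> * Y x)\<^sup>2 / 2 \<le> exp (\<epsilon> * Y x)" for x
    using \<epsilon>_pos Y_nonneg[of x] by (intro exp_lower_Taylor_quadratic) auto
  have "\<epsilon> * Y x \<le> exp (\<epsilon> * Y x)" for x
    using exp_ge_add_one_self[of "\<epsilon> * Y x"] by linarith
  then show "integrable P Y"
    using \<epsilon>_pos Y_nonneg by (intro integrable_exp_bound[where K = "1 / \<epsilon>"]) (auto simp: field_simps)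
  have "(\<epsilon> * Y x)\<^sup>2 \<le> 2 * exp (\<epsilon> * Y x)" for x
    using q[of x] \<epsilon>_pos Y_nonneg[of x] mult_nonneg_nonneg[of \<epsilon> "Y x"] by linarith
  then show "integrable P (\<lambda>x. (Y x)\<^sup>2)"
    using \<epsilon>_pos by (intro integrable_exp_bound[where K = "2 / \<epsilon>\<^sup>2"]) (auto simp: field_simps power_mult_distrib)
qed

lemma integrable_inner: "integrable P (\<lambda>x. y x \<bullet> u)"
  by (rule Bochner_Integration.integrable_bound[OF integrable_mult_right[OF integrable_Y, of "norm u"]])
    (auto intro!: AE_I2 order.trans[OF inner_le_Y abs_ge_self])

lemma integrable_inner_mult: "integrable P (\<lambda>x. (y x \<bullet> u) * (y x \<bullet> u'))"
proof (rule Bochner_Integration.integrable_bound[OF integrable_mult_right[OF integrable_Y_sq, of "norm u * norm u'"]])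
  show "AE x in P. norm ((y x \<bullet> u) * (y x \<bullet> u')) \<le> norm (norm u * norm u' * (Y x)\<^sup>2)"
  proof (rule AE_I2)
    fix x
    have "\<bar>y x \<bullet> u\<bar> * \<bar>y x \<bullet> u'\<bar> \<le> (norm u * Y x) * (norm u' * Y x)"
      using Y_nonneg[of x] by (intro mult_mono inner_le_Y) auto
    then show "norm ((y x \<bullet> u) * (y x \<bullet> u')) \<le> norm (norm u * norm u' * (Y x)\<^sup>2)"
      by (simp add: abs_mult power2_eq_square mult_ac)
  qed
qed measurable

lemma y_axis: "y x $ i = y x \<bullet> axis i 1"
  by (simp add: inner_axis)

lemma integrable_c: "integrable P (\<lambda>x. c x $ i)"
proof -
  have "integrable P (\<lambda>x. y x \<bullet> axis i 1 + em_expect c \<eta> (\<lambda>x. c x $ i))"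
    by (intro Bochner_Integration.integrable_add integrable_inner) simp
  then show ?thesis by (simp add: inner_axis em_centred_def)
qed

lemma expect_y: "expect (em_density c \<eta>) (\<lambda>x. y x $ i) = 0"
  using integrable_c[of i] prob_space
  by (simp add: expect_def em_centred_def em_expect_def)

lemma expect_inner: "expect (em_density c \<eta>) (\<lambda>x. y x \<bullet> u) = 0"
proof -
  have "integrable P (\<lambda>x. y x $ i)" for i unfolding y_axis by (rule integrable_inner)
  then show ?thesis
    using expect_y by (simp add: expect_def inner_vec_def)
qed

lemma inner_in_Bspace: "(\<lambda>x. y x \<bullet> u) \<in> Bspace (em_density c \<eta>)"
proof -
  define r where "r = \<epsilon> / (norm u + 1)"
  have r: "r > 0" using \<epsilon>_pos by (simp add: r_def add_nonneg_pos)
  have "integrable P (\<lambda>x. exp (t * (y x \<bullet> u)))" if "\<bar>t\<bar> < r" for t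
  proof (rule integrable_exp_bound[where K = 1])
    fix x
    have "\<bar>t\<bar> * norm u \<le> r * (norm u + 1)" using that r by (intro mult_mono) auto
    also have "\<dots> = \<epsilon>" by (simp add: r_def add_nonneg_eq_0_iff)
    finally have "\<bar>t\<bar> * norm u * Y x \<le> \<epsilon> * Y x" using Y_nonneg by (intro mult_right_mono) auto
    moreover have "t * (y x \<bullet> u) \<le> \<bar>t\<bar> * (norm u * Y x)"
      using mult_left_mono[OF inner_le_Y[of x u], of "\<bar>t\<bar>"] by (simp add: abs_mult[symmetric])
    ultimately show "\<bar>exp (t * (y x \<bullet> u))\<bar> \<le> 1 * exp (\<epsilon> * Y x)" by (simp add: mult.assoc)
  qed measurable
  then show ?thesis
    using r integrable_inner expect_inner unfolding Bspace_def by auto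
qed

section \<open>The Luxemburg norm on the span of the centred statistics\<close>

definition unit_ball_radii :: "real^'m \<Rightarrow> real set" where
  "unit_ball_radii u = {r. 0 < r \<and> integrable P (\<lambda>x. cosh ((y x \<bullet> u) / r) - 1) \<and>
     expect (em_density c \<eta>) (\<lambda>x. cosh ((y x \<bullet> u) / r) - 1) \<le> 1}"

lemma Bnorm_inner: "Bnorm (em_density c \<eta>) (\<lambda>x. y x \<bullet> u) = Inf (unit_ball_radii u)"
  by (simp add: Bnorm_def unit_ball_radii_def)

lemma radii_upper: "\<exists>K>0. \<forall>u r. 0 < r \<longrightarrow> K * norm u \<le> r \<longrightarrow> r \<in> unit_ball_radii u"
proof -
  have int: "integrable P (\<lambda>x. cosh (\<epsilon> * Y x) - 1)"
  proof (rule integrable_exp_bound[where K = 1])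
    fix x
    have "0 \<le> sinh (\<epsilon> * Y x)" using \<epsilon>_pos Y_nonneg[of x] by simp
    then have "cosh (\<epsilon> * Y x) \<le> exp (\<epsilon> * Y x)"
      using sinh_plus_cosh[of "\<epsilon> * Y x"] by linarith
    then show "\<bar>cosh (\<epsilon> * Y x) - 1\<bar> \<le> 1 * exp (\<epsilon> * Y x)"
      using cosh_real_ge_1[of "\<epsilon> * Y x"] by linarith
  qed (unfold cosh_field_def, measurable)
  define M where "M = (\<integral>x. cosh (\<epsilon> * Y x) - 1 \<partial>P)"
  have M: "M \<ge> 0" unfolding M_def using cosh_real_ge_1 by (intro Bochner_Integration.integral_nonneg) simp
  \<comment> \<open>The mean \<open>M\<close> may exceed 1; scaling by \<open>\<kappa>\<close>
    repairs this, and \<open>K\<close> is the least slope for which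
    \<open>K * norm u \<le> r\<close> gives
    \<open>norm u / r \<le> \<kappa> * \<epsilon>\<close>.\<close>
  define \<kappa> where "\<kappa> = 1 / (M + 1)"
  have \<kappa>: "0 < \<kappa>" "\<kappa> \<le> 1" "\<kappa> * M \<le> 1" using M by (auto simp: \<kappa>_def field_simps)
  define K where "K = 1 / (\<kappa> * \<epsilon>)"
  have K: "K > 0" using \<kappa> \<epsilon>_pos by (simp add: K_def)
  have "r \<in> unit_ball_radii u" if r: "0 < r" "K * norm u \<le> r" for u r
  proof -
    have le: "cosh ((y x \<bullet> u) / r) - 1 \<le> \<kappa> * (cosh (\<epsilon> * Y x) - 1)" for x
    proof -
      have "norm u \<le> \<kappa> * \<epsilon> * r" using r(2) \<kappa> \<epsilon>_pos by (simp add: K_def field_simps)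
      then have "norm u * Y x \<le> \<kappa> * \<epsilon> * r * Y x" using Y_nonneg by (intro mult_right_mono) auto
      then have "\<bar>(y x \<bullet> u) / r\<bar> \<le> \<kappa> * (\<epsilon> * Y x)"
        using inner_le_Y[of x u] r by (simp add: field_simps)
      then have "cosh \<bar>(y x \<bullet> u) / r\<bar> \<le> cosh (\<kappa> * (\<epsilon> * Y x))"
        using \<kappa>(1) \<epsilon>_pos Y_nonneg[of x] by (subst cosh_real_nonneg_le_iff) auto
      then show ?thesis
        using cosh_scaled_le[of \<kappa> "\<epsilon> * Y x"] \<kappa>(1,2) unfolding cosh_real_abs by linarith
    qed
    have [measurable]: "(\<lambda>x. cosh ((y x \<bullet> u) / r) - 1) \<in> borel_measurable borel"
      unfolding cosh_field_def by measurable
    have i: "integrable P (\<lambda>x. cosh ((y x \<bullet> u) / r) - 1)"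
      using le cosh_real_ge_1
      by (intro Bochner_Integration.integrable_bound[OF integrable_mult_right[OF int, of \<kappa>]])
        (auto intro!: AE_I2 order.trans[OF _ abs_ge_self])
    then have "(\<integral>x. cosh ((y x \<bullet> u) / r) - 1 \<partial>P) \<le> (\<integral>x. \<kappa> * (cosh (\<epsilon> * Y x) - 1) \<partial>P)"
      using int le by (intro integral_mono) auto
    also have "\<dots> = \<kappa> * M" by (simp add: M_def)
    finally show ?thesis using i r \<kappa> by (simp add: unit_ball_radii_def expect_def)
  qed
  then show ?thesis using K by blast
qed

text \<open>\<open>Inf\<close> on the reals is meaningful only for nonempty sets bounded below; this
  and \<open>radii_bdd_below\<close> give \<open>Bnorm\<close> its intended value.\<close>

lemma radii_nonempty: "unit_ball_radii u \<noteq> {}"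
proof -
  obtain K where K: "K > 0" "\<And>u r. 0 < r \<Longrightarrow> K * norm u \<le> r \<Longrightarrow> r \<in> unit_ball_radii u"
    using radii_upper by blast
  have "K * norm u + 1 \<in> unit_ball_radii u" using K(1) by (intro K(2)) (auto intro: add_nonneg_pos)
  then show ?thesis by blast
qed

lemma radii_bdd_below: "bdd_below (unit_ball_radii u)"
  by (rule bdd_belowI[of _ 0]) (simp add: unit_ball_radii_def)

lemma Bnorm_upper: "\<exists>K. \<forall>u. Bnorm (em_density c \<eta>) (\<lambda>x. y x \<bullet> u) \<le> K * norm u"
proof -
  obtain K where K: "K > 0" "\<And>u r. 0 < r \<Longrightarrow> K * norm u \<le> r \<Longrightarrow> r \<in> unit_ball_radii u"
    using radii_upper by blast
  have "Bnorm (em_density c \<eta>) (\<lambda>x. y x \<bullet> u) \<le> K * norm u" for u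
  proof (rule field_le_epsilon)
    fix e :: real assume "e > 0"
    then have "K * norm u + e \<in> unit_ball_radii u" using K(1) by (intro K(2)) (auto intro: add_nonneg_pos)
    then show "Bnorm (em_density c \<eta>) (\<lambda>x. y x \<bullet> u) \<le> K * norm u + e"
      unfolding Bnorm_inner by (intro cInf_lower radii_bdd_below)
  qed
  then show ?thesis by blast
qed

lemma fisher_mult: "(fisher c \<eta> *v u) $ j = (\<integral>x. (y x \<bullet> u) * (y x $ j) \<partial>P)"
proof -
  have i: "integrable P (\<lambda>x. y x $ j * y x $ i)" for i
    unfolding y_axis by (rule integrable_inner_mult)
  have "(\<integral>x. (y x \<bullet> u) * (y x $ j) \<partial>P) = (\<integral>x. (\<Sum>i\<in>UNIV. u $ i * (y x $ j * y x $ i)) \<partial>P)"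
    by (intro Bochner_Integration.integral_cong) (auto simp: inner_vec_def sum_distrib_left sum_distrib_right mult_ac)
  also have "\<dots> = (\<Sum>i\<in>UNIV. u $ i * (\<integral>x. y x $ j * y x $ i \<partial>P))"
    using i by simp
  finally show ?thesis
    by (simp add: matrix_vector_mult_def fisher_def em_inner_def em_expect_def expect_def mult.commute)
qed

text \<open>An admissible radius \<open>r\<close> bounds the second moment of the inner product over
  \<open>r\<close> by 4, so its covariances with the statistics are of order \<open>r\<close>. These
  covariances form the Fisher matrix applied to \<open>u\<close>, from which the inverse recovers
  \<open>u\<close>.\<close>

lemma Bnorm_lower:
  assumes inv: "invertible (fisher c \<eta>)"
  shows "\<exists>K>0. \<forall>u. norm u \<le> K * Bnorm (em_density c \<eta>) (\<lambda>x. y x \<bullet> u)"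
proof -
  obtain A where A: "A ** fisher c \<eta> = mat 1" using inv by (auto simp: invertible_def)
  obtain B where B: "B > 0" "\<And>z. norm (A *v z) \<le> norm z * B"
    using bounded_linear.pos_bounded[OF matrix_vector_mul_bounded_linear[of A]] by blast
  define m where "m j = (\<integral>x. (y x $ j)\<^sup>2 \<partial>P)" for j
  define C where "C = (\<Sum>j\<in>UNIV. (4 + m j) / 2)"
  have m: "m j \<ge> 0" for j unfolding m_def by (intro Bochner_Integration.integral_nonneg) simp
  have C: "C > 0" unfolding C_def using m by (intro sum_pos) (auto intro: add_pos_nonneg)
  have am: "\<bar>p * q\<bar> \<le> (p\<^sup>2 + q\<^sup>2) / 2" for p q :: real
    using sum_squares_bound[of "\<bar>p\<bar>" "\<bar>q\<bar>"] by (simp add: abs_mult)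
  have rad: "norm u \<le> C * B * r" if r: "r \<in> unit_ball_radii u" for u r
  proof -
    let ?z = "\<lambda>x. (y x \<bullet> u) / r"
    have r0: "r > 0" and i: "integrable P (\<lambda>x. cosh (?z x) - 1)" and le: "(\<integral>x. cosh (?z x) - 1 \<partial>P) \<le> 1"
      using r by (auto simp: unit_ball_radii_def expect_def)
    have iz: "integrable P (\<lambda>x. (?z x)\<^sup>2)"
      using integrable_divide[OF integrable_inner_mult[of u u], of "r\<^sup>2"]
      by (simp add: power_divide power2_eq_square)
    have "(\<integral>x. (?z x)\<^sup>2 \<partial>P) \<le> (\<integral>x. 4 * (cosh (?z x) - 1) \<partial>P)"
      by (intro integral_mono cosh_quadratic_lower integrable_mult_right i iz)
    also have "\<dots> \<le> 4" using le unfolding integral_mult_right_zero by linarith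
    finally have z4: "(\<integral>x. (?z x)\<^sup>2 \<partial>P) \<le> 4" .
    have "\<bar>(fisher c \<eta> *v u) $ j\<bar> \<le> r * ((4 + m j) / 2)" for j
    proof -
      have iy: "integrable P (\<lambda>x. (y x $ j)\<^sup>2)"
        using integrable_inner_mult[of "axis j 1" "axis j 1"] by (simp add: inner_axis power2_eq_square)
      have "(fisher c \<eta> *v u) $ j = r * (\<integral>x. ?z x * y x $ j \<partial>P)"
        unfolding fisher_mult using r0 by simp
      also have "\<bar>\<dots>\<bar> \<le> r * (\<integral>x. ((?z x)\<^sup>2 + (y x $ j)\<^sup>2) / 2 \<partial>P)"
      proof -
        have "\<bar>\<integral>x. ?z x * y x $ j \<partial>P\<bar> \<le> (\<integral>x. \<bar>?z x * y x $ j\<bar> \<partial>P)"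
          by (rule integral_abs_bound)
        also have "\<dots> \<le> (\<integral>x. ((?z x)\<^sup>2 + (y x $ j)\<^sup>2) / 2 \<partial>P)"
        proof (rule integral_mono)
          have "integrable P (\<lambda>x. ?z x * y x $ j)"
            using integrable_divide[OF integrable_inner_mult[of u "axis j 1"], of r]
            by (simp add: inner_axis)
          then show "integrable P (\<lambda>x. \<bar>?z x * y x $ j\<bar>)"
            by (rule integrable_abs)
          show "\<bar>?z x * y x $ j\<bar> \<le> ((?z x)\<^sup>2 + (y x $ j)\<^sup>2) / 2" for x
            by (rule am)
        qed (use iz iy in simp)
        finally show ?thesis
          unfolding abs_mult[of r] abs_of_pos[OF r0] by (rule mult_left_mono[OF _ less_imp_le[OF r0]])
      qed
      also have "(\<integral>x. ((?z x)\<^sup>2 + (y x $ j)\<^sup>2) / 2 \<partial>P) = ((\<integral>x. (?z x)\<^sup>2 \<partial>P) + m j) / 2"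
        using iz iy by (simp add: m_def)
      also have "r * \<dots> \<le> r * ((4 + m j) / 2)"
        using z4 r0 by (intro mult_left_mono) auto
      finally show ?thesis .
    qed
    then have "norm (fisher c \<eta> *v u) \<le> (\<Sum>j\<in>UNIV. r * ((4 + m j) / 2))"
      by (intro order.trans[OF norm_le_l1_cart] sum_mono)
    then have n: "norm (fisher c \<eta> *v u) \<le> r * C" by (simp add: C_def sum_distrib_left)
    have "u = A *v (fisher c \<eta> *v u)" by (simp add: matrix_vector_mul_assoc A)
    then have "norm u \<le> norm (fisher c \<eta> *v u) * B" using B(2) by metis
    also have "\<dots> \<le> r * C * B" using n B(1) by simp
    finally show ?thesis by (simp add: mult_ac)
  qed
  have "norm u \<le> C * B * Bnorm (em_density c \<eta>) (\<lambda>x. y x \<bullet> u)" for u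
  proof -
    have "norm u / (C * B) \<le> Inf (unit_ball_radii u)"
      using rad C B(1) by (intro cInf_greatest radii_nonempty) (simp add: field_simps)
    then show ?thesis using C B(1) unfolding Bnorm_inner by (simp add: field_simps)
  qed
  then show ?thesis using C B(1) by (intro exI[of _ "C * B"]) auto
qed

section \<open>Tangent vectors as parameter velocities\<close>

lemma exp_coord_eq: "exp_coord (em_density c \<eta>) (em_density c \<zeta>) x = y x \<bullet> (\<zeta> - \<eta>)"
proof -
  \<comment> \<open>The log-ratio is affine in \<open>c\<close>; centring removes the normalising
    constants.\<close>
  have l: "ln (em_density c \<zeta> x / em_density c \<eta> x) =
      c x \<bullet> (\<zeta> - \<eta>) - (log_partition c \<zeta> - log_partition c \<eta>)" for x
    by (simp add: em_density_def exp_diff[symmetric] inner_diff_right inner_commute)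
  have y: "y x \<bullet> u = c x \<bullet> u - (\<Sum>i\<in>UNIV. em_expect c \<eta> (\<lambda>x. c x $ i) * u $ i)" for x u
    by (simp add: inner_vec_def em_centred_def left_diff_distrib sum_subtractf)
  have c: "integrable P (\<lambda>x. c x \<bullet> u)"
    "(\<integral>x. c x \<bullet> u \<partial>P) = (\<Sum>i\<in>UNIV. em_expect c \<eta> (\<lambda>x. c x $ i) * u $ i)" for u
    using integrable_c by (auto simp: inner_vec_def em_expect_def expect_def)
  show ?thesis
    unfolding exp_coord_def l y using c prob_space by (simp add: expect_def)
qed

lemma has_tangent_vector_iff:
  assumes inv: "invertible (fisher c \<eta>)" and \<theta>: "\<theta> t = \<eta>"
  shows "has_tangent_vector (\<lambda>s. em_density c (\<theta> s)) (\<lambda>x. y x \<bullet> D) t I \<longleftrightarrow>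
    (\<theta> has_vector_derivative D) (at t within I)"
proof -
  define \<Delta> where "\<Delta> s = (\<theta> s - \<theta> t) /\<^sub>R (s - t) - D" for s
  let ?n = "\<lambda>u. Bnorm (em_density c \<eta>) (\<lambda>x. y x \<bullet> u)"
  obtain K where K: "\<And>u. ?n u \<le> K * norm u" using Bnorm_upper by blast
  obtain K' where K': "K' > 0" "\<And>u. norm u \<le> K' * ?n u" using Bnorm_lower[OF inv] by blast
  have n0: "0 \<le> ?n u" for u
    using K'(1) order.trans[OF norm_ge_zero K'(2)] by (simp add: zero_le_mult_iff)
  have q: "(exp_coord (em_density c (\<theta> t)) (em_density c (\<theta> s)) x
        - exp_coord (em_density c (\<theta> t)) (em_density c (\<theta> t)) x) / (s - t) - y x \<bullet> D = y x \<bullet> \<Delta> s" for s x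
    unfolding \<theta> exp_coord_eq \<Delta>_def
    by (simp add: inner_diff_right \<theta> divide_inverse mult.commute)
  \<comment> \<open>\<open>inner_in_Bspace\<close> settles both membership conditions, leaving only
    the convergence in norm.\<close>
  have "has_tangent_vector (\<lambda>s. em_density c (\<theta> s)) (\<lambda>x. y x \<bullet> D) t I \<longleftrightarrow>
      ((\<lambda>s. ?n (\<Delta> s)) \<longlongrightarrow> 0) (at t within I)"
    unfolding has_tangent_vector_def q unfolding \<theta> exp_coord_eq[abs_def]
    using inner_in_Bspace by simp
  also have "\<dots> \<longleftrightarrow> ((\<lambda>s. norm (\<Delta> s)) \<longlongrightarrow> 0) (at t within I)"
  proof
    assume "((\<lambda>s. ?n (\<Delta> s)) \<longlongrightarrow> 0) (at t within I)"
    then have "((\<lambda>s. K' * ?n (\<Delta> s)) \<longlongrightarrow> 0) (at t within I)"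
      by (rule tendsto_mult_right_zero)
    moreover have "\<forall>\<^sub>F s in at t within I. norm (norm (\<Delta> s)) \<le> K' * ?n (\<Delta> s)"
      unfolding real_norm_def abs_norm_cancel by (intro always_eventually allI K'(2))
    ultimately show "((\<lambda>s. norm (\<Delta> s)) \<longlongrightarrow> 0) (at t within I)"
      by (rule Lim_null_comparison[rotated])
  next
    assume "((\<lambda>s. norm (\<Delta> s)) \<longlongrightarrow> 0) (at t within I)"
    then have "((\<lambda>s. K * norm (\<Delta> s)) \<longlongrightarrow> 0) (at t within I)"
      by (rule tendsto_mult_right_zero)
    moreover have "\<forall>\<^sub>F s in at t within I. norm (?n (\<Delta> s)) \<le> K * norm (\<Delta> s)"
      unfolding real_norm_def abs_of_nonneg[OF n0] by (intro always_eventually allI K)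
    ultimately show "((\<lambda>s. ?n (\<Delta> s)) \<longlongrightarrow> 0) (at t within I)"
      by (rule Lim_null_comparison[rotated])
  qed
  also have "\<dots> \<longleftrightarrow> (\<theta> has_vector_derivative D) (at t within I)"
    unfolding has_vector_derivative_iff_quotient \<Delta>_def ..
  finally show ?thesis .
qed

lemma fisher_symmetric: "(fisher c \<eta> *v u) \<bullet> u' = u \<bullet> (fisher c \<eta> *v u')"
proof -
  have "transpose (fisher c \<eta>) = fisher c \<eta>"
    by (simp add: transpose_def fisher_def em_inner_def vec_eq_iff mult.commute)
  then show ?thesis by (metis dot_lmul_matrix inner_commute transpose_matrix_vector)
qed

text \<open>Links the two forms of the projected equation: the inverse matrix may act on the centred
  statistics or on the mean of the generator.\<close>

lemma matrix_inv_fisher_symmetric: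
  assumes "invertible (fisher c \<eta>)"
  shows "u \<bullet> (matrix_inv (fisher c \<eta>) *v u') = (matrix_inv (fisher c \<eta>) *v u) \<bullet> u'"
proof -
  let ?g = "fisher c \<eta>" and ?h = "matrix_inv (fisher c \<eta>)"
  have "?g ** ?h = mat 1"
    using assms unfolding invertible_def matrix_inv_def by (metis (mono_tags, lifting) someI_ex)
  then have "?g *v (?h *v z) = z" for z by (simp add: matrix_vector_mul_assoc)
  then show ?thesis using fisher_symmetric[of "?h *v u" "?h *v u'"] by simp
qed

end

section \<open>Projection of the Fokker-Planck vector\<close>

lemma Ck_1D:
  assumes "Ck 1 \<phi>"
  shows "(\<phi> has_real_derivative deriv \<phi> x) (at x)" "continuous_on UNIV (deriv \<phi>)"
  using assms by (auto simp: Ck_def differentiable_on_def DERIV_deriv_iff_real_differentiable)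

lemma Ck_2D:
  assumes "Ck 2 \<phi>"
  shows "(\<phi> has_real_derivative deriv \<phi> x) (at x)"
    "(deriv \<phi> has_real_derivative deriv (deriv \<phi>) x) (at x)"
    "continuous_on UNIV (deriv (deriv \<phi>))"
proof -
  have "\<phi> differentiable_on UNIV" "deriv \<phi> differentiable_on UNIV"
    using assms by (auto simp: Ck_def numeral_2_eq_2 less_Suc_eq)
  moreover have "continuous_on UNIV (deriv (deriv \<phi>))"
    using assms by (simp add: Ck_def eval_nat_numeral)
  ultimately show "(\<phi> has_real_derivative deriv \<phi> x) (at x)"
    "(deriv \<phi> has_real_derivative deriv (deriv \<phi>) x) (at x)"
    "continuous_on UNIV (deriv (deriv \<phi>))"
    by (auto simp: differentiable_on_def DERIV_deriv_iff_real_differentiable)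
qed

lemma inner_vec_has_real_derivative:
  fixes c c1 :: "real \<Rightarrow> real^'m"
  assumes "\<And>i. ((\<lambda>x. c x $ i) has_real_derivative c1 x $ i) (at x)"
  shows "((\<lambda>x. \<zeta> \<bullet> c x) has_real_derivative \<zeta> \<bullet> c1 x) (at x)"
  unfolding inner_vec_def using assms
  by (auto intro!: DERIV_sum derivative_eq_intros)

text \<open>Since p' = u' p, every term carries the factor \<open>p\<close>, and the quotient
  depends neither on \<open>p\<close> nor on the normalisation \<open>k\<close>.\<close>

lemma fokker_planck_op_exp:
  assumes df: "\<And>x. (f t has_real_derivative f1 x) (at x)"
    and da: "\<And>x. (a t has_real_derivative a1 x) (at x)" and da1: "\<And>x. (a1 has_real_derivative a2 x) (at x)"
    and du: "\<And>x. (u has_real_derivative u1 x) (at x)" and du1: "\<And>x. (u1 has_real_derivative u2 x) (at x)"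
    and p: "\<And>x. p x = exp (u x - k)"
  shows "fokker_planck_op f a t p x / p x =
    - f1 x - f t x * u1 x + (a2 x + 2 * a1 x * u1 x + a t x * (u2 x + (u1 x)\<^sup>2)) / 2"
proof -
  have dp: "(p has_real_derivative u1 x * p x) (at x)" for x
    unfolding p[abs_def] by (auto intro!: derivative_eq_intros du simp: p)
  have 1: "deriv (\<lambda>y. f t y * p y) x = f1 x * p x + f t x * (u1 x * p x)"
    by (rule DERIV_imp_deriv) (auto intro!: derivative_eq_intros df dp)
  have "deriv (\<lambda>y. a t y * p y) = (\<lambda>x. (a1 x + a t x * u1 x) * p x)"
    by (rule ext, rule DERIV_imp_deriv) (auto intro!: derivative_eq_intros da dp simp: algebra_simps)
  then have 2: "deriv (deriv (\<lambda>y. a t y * p y)) x =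
      (a2 x + (a1 x * u1 x + a t x * u2 x)) * p x + (a1 x + a t x * u1 x) * (u1 x * p x)"
    by (simp only:) (rule DERIV_imp_deriv,
      auto intro!: derivative_eq_intros da da1 du1 dp simp: algebra_simps)
  have "p x \<noteq> 0" by (simp add: p)
  then show ?thesis
    unfolding fokker_planck_op_def 1 2 by (simp add: field_simps power2_eq_square)
qed

lemma open_line_segment:
  fixes \<theta> d :: "'a::real_normed_vector"
  assumes "open \<Theta>" "\<theta> \<in> \<Theta>"
  obtains \<epsilon> where "\<epsilon> > 0" "\<And>s. \<bar>s\<bar> \<le> 2 \<Longrightarrow> \<theta> + s *\<^sub>R \<epsilon> *\<^sub>R d \<in> \<Theta>"
proof -
  obtain r where r: "r > 0" "ball \<theta> r \<subseteq> \<Theta>"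
    using assms by (auto simp: open_contains_ball)
  \<comment> \<open>The 2 accommodates the range of \<open>s\<close>; the 1 keeps the denominator
    positive when \<open>d\<close> is zero.\<close>
  define \<epsilon> where "\<epsilon> = r / (2 * norm d + 1)"
  have p: "0 < 2 * norm d + 1" by (simp add: add_nonneg_pos)
  then have "\<epsilon> > 0" using r by (simp add: \<epsilon>_def)
  moreover have "\<theta> + s *\<^sub>R \<epsilon> *\<^sub>R d \<in> \<Theta>" if "\<bar>s\<bar> \<le> 2" for s
  proof -
    have "\<bar>s\<bar> * (\<epsilon> * norm d) \<le> 2 * (\<epsilon> * norm d)"
      using that \<open>\<epsilon> > 0\<close> by (intro mult_right_mono) auto
    also have "\<dots> < \<epsilon> * (2 * norm d + 1)" using \<open>\<epsilon> > 0\<close> by (simp add: algebra_simps)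
    also have "\<dots> = r" using p by (simp add: \<epsilon>_def)
    finally have "dist \<theta> (\<theta> + s *\<^sub>R \<epsilon> *\<^sub>R d) < r"
      using \<open>\<epsilon> > 0\<close> by (simp add: dist_norm abs_mult mult.assoc)
    then show ?thesis using r by auto
  qed
  ultimately show ?thesis by (rule that)
qed

locale em_diffusion =
  fixes c :: "real \<Rightarrow> real^'m" and \<Theta> :: "(real^'m) set"
    and f a :: "real \<Rightarrow> real \<Rightarrow> real" and t :: real
  assumes fam: "exponential_family c \<Theta>"
    and Ck_f: "Ck 1 (f t)" and Ck_a: "Ck 2 (a t)" and Ck_c: "\<And>i. Ck 2 (\<lambda>x. c x $ i)"
    and a_nonneg: "\<And>x. 0 \<le> a t x"
    and sq_int: "\<And>\<eta>. \<eta> \<in> \<Theta> \<Longrightarrow>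
      integrable (dens_measure (em_density c \<eta>)) (\<lambda>x. (fp_vector f a t c \<eta> x)\<^sup>2)"
begin

definition c1 :: "real \<Rightarrow> real^'m" where "c1 x = (\<chi> i. deriv (\<lambda>x. c x $ i) x)"
definition c2 :: "real \<Rightarrow> real^'m" where "c2 x = (\<chi> i. deriv (deriv (\<lambda>x. c x $ i)) x)"

lemma deriv_inner:
  "((\<lambda>x. \<zeta> \<bullet> c x) has_real_derivative \<zeta> \<bullet> c1 x) (at x)"
  "((\<lambda>x. \<zeta> \<bullet> c1 x) has_real_derivative \<zeta> \<bullet> c2 x) (at x)"
  using Ck_2D(1,2)[OF Ck_c] by (auto intro!: inner_vec_has_real_derivative simp: c1_def c2_def)

lemma cont_c2: "continuous_on UNIV (\<lambda>x. \<zeta> \<bullet> c2 x)"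
  unfolding inner_vec_def c2_def using Ck_2D(3)[OF Ck_c] by (auto intro!: continuous_intros)

lemma em_pointI: "\<eta> \<in> \<Theta> \<Longrightarrow> em_point c \<Theta> \<eta>"
  using fam Ck_2D(1)[OF Ck_c]
  by unfold_locales (auto intro!: continuous_at_imp_continuous_on DERIV_isCont)

lemma fp_vector_eq:
  "fp_vector f a t c \<eta> x = - deriv (f t) x - f t x * (\<eta> \<bullet> c1 x)
     + (deriv (deriv (a t)) x + 2 * deriv (a t) x * (\<eta> \<bullet> c1 x) + a t x * (\<eta> \<bullet> c2 x + (\<eta> \<bullet> c1 x)\<^sup>2)) / 2"
  unfolding fp_vector_def
  by (rule fokker_planck_op_exp[where u = "\<lambda>x. \<eta> \<bullet> c x" and k = "log_partition c \<eta>"])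
    (simp_all add: Ck_1D[OF Ck_f] Ck_2D[OF Ck_a] deriv_inner em_density_def)

lemma generator_eq: "generator f a t (\<lambda>x. c x $ i) x = f t x * c1 x $ i + a t x * c2 x $ i / 2"
  by (simp add: generator_def c1_def c2_def)

lemma continuous_fp_vector: "continuous_on UNIV (fp_vector f a t c \<eta>)"
proof -
  have "continuous_on UNIV (f t)" "continuous_on UNIV (a t)" "continuous_on UNIV (deriv (a t))"
    "continuous_on UNIV (\<lambda>x. \<eta> \<bullet> c1 x)"
    using Ck_1D(1)[OF Ck_f] Ck_2D(1,2)[OF Ck_a] deriv_inner(2)
    by (auto intro!: continuous_at_imp_continuous_on DERIV_isCont)
  then show ?thesis
    unfolding fp_vector_eq[abs_def] using Ck_1D(2)[OF Ck_f] Ck_2D(3)[OF Ck_a] cont_c2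
    by (intro continuous_on_add continuous_on_diff continuous_on_minus continuous_on_mult
        continuous_on_divide continuous_on_power continuous_on_const) auto
qed

lemma continuous_generator: "continuous_on UNIV (generator f a t (\<lambda>x. c x $ i))"
proof -
  have "continuous_on UNIV (f t)" "continuous_on UNIV (a t)" "continuous_on UNIV (\<lambda>x. c1 x $ i)"
    using Ck_1D(1)[OF Ck_f] Ck_2D(1)[OF Ck_a] Ck_2D(2)[OF Ck_c, of i]
    by (auto intro!: continuous_at_imp_continuous_on DERIV_isCont simp: c1_def)
  moreover have "continuous_on UNIV (\<lambda>x. c2 x $ i)"
    using Ck_2D(3)[OF Ck_c, of i] by (simp add: c2_def)
  ultimately show ?thesis
    unfolding generator_eq[abs_def]
    by (intro continuous_on_add continuous_on_mult continuous_on_divide continuous_on_const) auto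
qed

lemma fp_lineI:
  assumes "\<And>s. \<bar>s\<bar> \<le> 2 \<Longrightarrow> \<eta> + s *\<^sub>R d \<in> \<Theta>"
  shows "fp_line (f t) (deriv (f t)) (a t) (deriv (a t)) (deriv (deriv (a t)))
    (\<lambda>x. \<eta> \<bullet> c x) (\<lambda>x. \<eta> \<bullet> c1 x) (\<lambda>x. \<eta> \<bullet> c2 x) (\<lambda>x. d \<bullet> c x) (\<lambda>x. d \<bullet> c1 x) (\<lambda>x. d \<bullet> c2 x)"
proof
  fix s :: real assume s: "s \<in> {-2, -1, 0, 1, 2}"
  let ?\<zeta> = "\<eta> + s *\<^sub>R d"
  have \<zeta>: "?\<zeta> \<in> \<Theta>" using assms[of s] s by auto
  then interpret em_point c \<Theta> ?\<zeta> by (rule em_pointI)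
  have e: "?\<zeta> \<bullet> z = \<eta> \<bullet> z + s * (d \<bullet> z)" for z by (simp add: inner_add_left)
  show "integrable lborel (\<lambda>x. exp (\<eta> \<bullet> c x + s * (d \<bullet> c x)))"
    using integrable_exp[OF \<zeta>] by (simp only: e)
  have "(\<lambda>x. (fp_vector f a t c ?\<zeta> x)\<^sup>2) \<in> borel_measurable borel"
    by (intro borel_measurable_continuous_onI continuous_on_power continuous_fp_vector)
  from integrable_P_iff[OF this, of ?\<zeta>] sq_int[OF \<zeta>]
  show "integrable lborel (\<lambda>x. (- deriv (f t) x - f t x * (\<eta> \<bullet> c1 x + s * (d \<bullet> c1 x))
      + (deriv (deriv (a t)) x + 2 * deriv (a t) x * (\<eta> \<bullet> c1 x + s * (d \<bullet> c1 x))
        + a t x * (\<eta> \<bullet> c2 x + s * (d \<bullet> c2 x) + (\<eta> \<bullet> c1 x + s * (d \<bullet> c1 x))\<^sup>2)) / 2)\<^sup>2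
      * exp (\<eta> \<bullet> c x + s * (d \<bullet> c x)))"
    by (simp only: fp_vector_eq e)
qed (auto intro: Ck_1D[OF Ck_f] Ck_2D[OF Ck_a] deriv_inner cont_c2 a_nonneg)

text \<open>The direction \<open>- \<eta>\<close> points to the origin of parameter space, so the
  tilt is a negative multiple of the log-weight, as \<open>flux_limit_eq_0\<close> requires.\<close>

lemma flux_vanishes:
  assumes "\<eta> \<in> \<Theta>" "F = at_top \<or> F = at_bot"
  shows "((\<lambda>x. (f t x - (deriv (a t) x + a t x * (\<eta> \<bullet> c1 x)) / 2) * exp (\<eta> \<bullet> c x)) \<longlongrightarrow> 0) F"
proof -
  obtain \<epsilon> where \<epsilon>: "\<epsilon> > 0" "\<And>s. \<bar>s\<bar> \<le> 2 \<Longrightarrow> \<eta> + s *\<^sub>R \<epsilon> *\<^sub>R (- \<eta>) \<in> \<Theta>"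
    using open_line_segment[of \<Theta> \<eta> "- \<eta>"] fam assms by (auto simp: exponential_family_def)
  interpret fp_line "f t" "deriv (f t)" "a t" "deriv (a t)" "deriv (deriv (a t))"
    "\<lambda>x. \<eta> \<bullet> c x" "\<lambda>x. \<eta> \<bullet> c1 x" "\<lambda>x. \<eta> \<bullet> c2 x"
    "\<lambda>x. (\<epsilon> *\<^sub>R - \<eta>) \<bullet> c x" "\<lambda>x. (\<epsilon> *\<^sub>R - \<eta>) \<bullet> c1 x" "\<lambda>x. (\<epsilon> *\<^sub>R - \<eta>) \<bullet> c2 x"
    by (rule fp_lineI[OF \<epsilon>(2)])
  have "(flux 0 \<longlongrightarrow> 0) F"
    by (rule flux_limit_eq_0[OF _ \<epsilon>(1) assms(2)]) simp
  then show ?thesis unfolding flux_def[abs_def] w_def by simp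
qed

text \<open>In the direction of axis \<open>i\<close> the tilt is a multiple of the statistic
  \<open>c x $ i\<close>, and \<open>integral_generator\<close> gives the identity for the uncentred
  statistic. Centring changes nothing, as \<open>fp_vector\<close> has mean 0 by
  \<open>integral_rate\<close>.\<close>

lemma weak_form:
  assumes \<eta>: "\<eta> \<in> \<Theta>"
  shows "integrable (dens_measure (em_density c \<eta>)) (generator f a t (\<lambda>x. c x $ i))"
    "em_inner c \<eta> (fp_vector f a t c \<eta>) (\<lambda>x. em_centred c \<eta> x $ i) =
      em_expect c \<eta> (generator f a t (\<lambda>x. c x $ i))"
proof -
  interpret em_point c \<Theta> \<eta> by (rule em_pointI[OF \<eta>])
  obtain \<epsilon> where \<epsilon>: "\<epsilon> > 0" "\<And>s. \<bar>s\<bar> \<le> 2 \<Longrightarrow> \<eta> + s *\<^sub>R \<epsilon> *\<^sub>R (axis i 1) \<in> \<Theta>"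
    using open_line_segment[of \<Theta> \<eta> "axis i 1"] fam \<eta> by (auto simp: exponential_family_def)
  interpret L: fp_line "f t" "deriv (f t)" "a t" "deriv (a t)" "deriv (deriv (a t))"
    "\<lambda>x. \<eta> \<bullet> c x" "\<lambda>x. \<eta> \<bullet> c1 x" "\<lambda>x. \<eta> \<bullet> c2 x"
    "\<lambda>x. (\<epsilon> *\<^sub>R axis i 1) \<bullet> c x" "\<lambda>x. (\<epsilon> *\<^sub>R axis i 1) \<bullet> c1 x" "\<lambda>x. (\<epsilon> *\<^sub>R axis i 1) \<bullet> c2 x"
    by (rule fp_lineI[OF \<epsilon>(2)])
  have fl: "(L.flux s \<longlongrightarrow> 0) F" if "s \<in> {-2, -1, 0, 1, 2}" "F = at_top \<or> F = at_bot" for s F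
  proof -
    have "\<eta> + s *\<^sub>R \<epsilon> *\<^sub>R (axis i 1) \<in> \<Theta>" using \<epsilon>(2)[of s] that by auto
    from flux_vanishes[OF this that(2)] show ?thesis
      unfolding L.flux_def[abs_def] L.w_def by (simp only: inner_add_left inner_scaleR_left)
  qed
  let ?\<alpha> = "fp_vector f a t c \<eta>" and ?L = "generator f a t (\<lambda>x. c x $ i)"
  have rate: "L.rate 0 = ?\<alpha>" unfolding L.rate_def[abs_def] fp_vector_eq[abs_def] by simp
  have w: "L.w 0 = (\<lambda>x. exp (\<eta> \<bullet> c x))" unfolding L.w_def[abs_def] by simp
  have gen: "f t x * ((\<epsilon> *\<^sub>R axis i 1) \<bullet> c1 x) + a t x * ((\<epsilon> *\<^sub>R axis i 1) \<bullet> c2 x) / 2 = \<epsilon> * ?L x" for x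
    by (simp add: generator_eq inner_axis' algebra_simps)
  have v: "(\<epsilon> *\<^sub>R axis i 1) \<bullet> c x = \<epsilon> * c x $ i" for x by (simp add: inner_axis')
  have [measurable]: "?\<alpha> \<in> borel_measurable borel" "?L \<in> borel_measurable borel"
    using continuous_fp_vector continuous_generator by (auto intro: borel_measurable_continuous_onI)
  have "integrable lborel (\<lambda>x. \<epsilon> * (?L x * exp (\<eta> \<bullet> c x)))"
    using L.integrable_generator unfolding gen w by (simp add: mult.assoc)
  then show "integrable P ?L"
    using \<epsilon>(1) by (subst integrable_P_iff) auto
  have "\<epsilon> * (\<integral>x. ?L x * exp (\<eta> \<bullet> c x) \<partial>lborel) = \<epsilon> * (\<integral>x. ?\<alpha> x * c x $ i * exp (\<eta> \<bullet> c x) \<partial>lborel)"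
    using L.integral_generator[OF fl] unfolding gen w rate unfolding v by (simp add: mult_ac)
  then have 1: "em_expect c \<eta> (\<lambda>x. ?\<alpha> x * c x $ i) = em_expect c \<eta> ?L"
    using \<epsilon>(1) by (simp add: em_expect_def expect_eq)
  have 2: "em_expect c \<eta> ?\<alpha> = 0"
    using L.integral_rate[OF fl] unfolding rate w by (simp add: em_expect_def expect_eq)
  have i1: "integrable P ?\<alpha>"
    using L.integrable_moments(1) unfolding rate w by (subst integrable_P_iff) auto
  have "integrable lborel (\<lambda>x. \<epsilon> * (?\<alpha> x * c x $ i * exp (\<eta> \<bullet> c x)))"
    using L.integrable_moments(4) unfolding rate w unfolding v by (simp add: mult_ac)
  then have i2: "integrable P (\<lambda>x. ?\<alpha> x * c x $ i)"
    using \<epsilon>(1) by (subst integrable_P_iff) auto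
  show "em_inner c \<eta> ?\<alpha> (\<lambda>x. em_centred c \<eta> x $ i) = em_expect c \<eta> ?L"
    using i1 i2 1 2 by (simp add: em_inner_def em_centred_def em_expect_def expect_def right_diff_distrib)
qed

lemma em_proj_eq:
  assumes "\<eta> \<in> \<Theta>"
  shows "em_proj c \<eta> (fp_vector f a t c \<eta>) x =
    em_centred c \<eta> x \<bullet> (matrix_inv (fisher c \<eta>) *v em_generator_expect f a t c \<eta>)"
  unfolding em_proj_def weak_form(2)[OF assms]
  by (simp add: inner_vec_def matrix_vector_mult_def em_generator_expect_def mult.commute)

end

theorem proposition11:
  fixes M :: "'w measure" and F :: "real \<Rightarrow> 'w measure"
    and W X :: "real \<Rightarrow> 'w \<Rightarrow> real"
    and f \<sigma> a :: "real \<Rightarrow> real \<Rightarrow> real"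
    and p0 :: "real \<Rightarrow> real"
    and c :: "real \<Rightarrow> real^'m" and \<Theta> :: "(real^'m) set"
    and I :: "real set" and \<theta> :: "real \<Rightarrow> real^'m" and t :: real
  assumes diffusion: "ito_diffusion M F W f \<sigma> X"
    and a_def: "\<And>t x. t \<ge> 0 \<Longrightarrow> a t x = (\<sigma> t x)\<^sup>2"
    and family: "exponential_family c \<Theta>"
    and fisher_inv: "\<And>\<eta>. \<eta> \<in> \<Theta> \<Longrightarrow> invertible (fisher c \<eta>)"
    and A: "distributed M lborel (X 0) (\<lambda>x. ennreal (p0 x))" "AE x in lborel. p0 x > 0"
    and B: "\<And>t. t \<ge> 0 \<Longrightarrow> Ck 1 (f t)" "\<And>x. continuous_on {0..} (\<lambda>t. f t x)"
           "\<And>t. t \<ge> 0 \<Longrightarrow> Ck 2 (a t)" "\<And>x. continuous_on {0..} (\<lambda>t. a t x)"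
    and C: "\<exists>K>0. \<forall>t\<ge>0. \<forall>x. 2 * x * f t x + a t x \<le> K * (1 + \<bar>x\<bar>\<^sup>2)"
    and E: "\<And>i. Ck 2 (\<lambda>x. c x $ i)"
    and F: "\<And>\<eta> t. \<eta> \<in> \<Theta> \<Longrightarrow> t \<ge> 0 \<Longrightarrow>
              integrable (dens_measure (em_density c \<eta>)) (\<lambda>x. (fp_vector f a t c \<eta> x)\<^sup>2)"
    and interval: "is_interval I" "interior I \<noteq> {}" "I \<subseteq> {0..}"
    and curve: "\<And>s. s \<in> I \<Longrightarrow> \<theta> s \<in> \<Theta>"
    and t: "t \<in> I"
  shows
    "(\<forall>i. integrable (dens_measure (em_density c (\<theta> t))) (generator f a t (\<lambda>x. c x $ i))) \<and>
     (\<forall>D. (\<theta> has_vector_derivative D) (at t within I) \<longrightarrow>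
        has_tangent_vector (\<lambda>s. em_density c (\<theta> s)) (\<lambda>x. em_centred c (\<theta> t) x \<bullet> D) t I) \<and>
     (\<forall>x. em_proj c (\<theta> t) (fp_vector f a t c (\<theta> t)) x =
        em_generator_expect f a t c (\<theta> t) \<bullet>
          (matrix_inv (fisher c (\<theta> t)) *v em_centred c (\<theta> t) x)) \<and>
     (has_tangent_vector (\<lambda>s. em_density c (\<theta> s))
         (em_proj c (\<theta> t) (fp_vector f a t c (\<theta> t))) t I \<longleftrightarrow>
        (\<exists>D. (\<theta> has_vector_derivative D) (at t within I) \<and>
             (\<forall>x. em_centred c (\<theta> t) x \<bullet> D =
                em_generator_expect f a t c (\<theta> t) \<bullet>
                  (matrix_inv (fisher c (\<theta> t)) *v em_centred c (\<theta> t) x)))) \<and>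
     (has_tangent_vector (\<lambda>s. em_density c (\<theta> s))
         (em_proj c (\<theta> t) (fp_vector f a t c (\<theta> t))) t I \<longleftrightarrow>
        (\<theta> has_vector_derivative
           (matrix_inv (fisher c (\<theta> t)) *v em_generator_expect f a t c (\<theta> t))) (at t within I))"
proof -
  have "0 \<le> t" using t interval(3) by auto
  have \<theta>t: "\<theta> t \<in> \<Theta>" by (rule curve[OF t])
  interpret em_diffusion c \<Theta> f a t
    using \<open>0 \<le> t\<close> family B(1,3) E F a_def by unfold_locales auto
  interpret em_point c \<Theta> "\<theta> t" by (rule em_pointI[OF \<theta>t])
  let ?G = "em_generator_expect f a t c (\<theta> t)" and ?h = "matrix_inv (fisher c (\<theta> t))"
  have inv: "invertible (fisher c (\<theta> t))" by (rule fisher_inv[OF \<theta>t])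
  have proj: "em_proj c (\<theta> t) (fp_vector f a t c (\<theta> t)) = (\<lambda>x. em_centred c (\<theta> t) x \<bullet> (?h *v ?G))"
    by (rule ext) (rule em_proj_eq[OF \<theta>t])
  have sym: "?G \<bullet> (?h *v z) = z \<bullet> (?h *v ?G)" for z
    by (simp add: matrix_inv_fisher_symmetric[OF inv, of ?G] inner_commute)
  have tv: "has_tangent_vector (\<lambda>s. em_density c (\<theta> s)) (\<lambda>x. em_centred c (\<theta> t) x \<bullet> D) t I \<longleftrightarrow>
      (\<theta> has_vector_derivative D) (at t within I)" for D
    by (rule has_tangent_vector_iff[where \<theta> = \<theta> and t = t, OF inv refl])
  have "(\<theta> has_vector_derivative (?h *v ?G)) (at t within I) \<longleftrightarrow>
      (\<exists>D. (\<theta> has_vector_derivative D) (at t within I) \<and>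
        (\<forall>x. em_centred c (\<theta> t) x \<bullet> D = em_centred c (\<theta> t) x \<bullet> (?h *v ?G)))"
  proof
    assume "\<exists>D. (\<theta> has_vector_derivative D) (at t within I) \<and>
      (\<forall>x. em_centred c (\<theta> t) x \<bullet> D = em_centred c (\<theta> t) x \<bullet> (?h *v ?G))"
    then obtain D where "(\<theta> has_vector_derivative D) (at t within I)"
      and D: "\<And>x. em_centred c (\<theta> t) x \<bullet> D = em_centred c (\<theta> t) x \<bullet> (?h *v ?G)" by blast
    \<comment> \<open>Equal functions of x are the same tangent vector, so \<open>tv\<close> for
      \<open>D\<close> and for \<open>?h *v ?G\<close> transfers the derivative.\<close>
    then show "(\<theta> has_vector_derivative (?h *v ?G)) (at t within I)"
      using tv[of D] tv[of "?h *v ?G"] unfolding D by blast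
  qed blast
  then show ?thesis
    unfolding proj sym tv using weak_form(1)[OF \<theta>t] by blast
qed

end
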